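(* Consider the sequence of double-ended queues described in the context, satisfying the standing assumptions. Assume that for some $x_0\in\mathbb{R}$, $\mathbb{E}(|\bar X^n(0)-x_0|)\to0$ as $n\to\infty$. Then for every $t\in[0,\infty)$, $$\mathbb{E}\Big(\sup_{0\le u\le t}|\bar X^n(u)-x(u)|\Big)\to0\quad\text{as }n\to\infty,$$ where $x$ is the (unique) solution of $$x(t)=x_0+(\alpha-\beta)t-\theta\int_0^t x^+(s)\,ds+\gamma\int_0^t x^-(s)\,ds,\qquad t\ge0 .$$
   Context: For each $n\in\mathbb{N}$, on a probability space, let $\{U^n_k\}_{k\in\mathbb{N}}$ and $\{V^n_k\}_{k\in\mathbb{N}}$ be independent i.i.d. sequences (seller and buyer inter-arrival times) with $\mathbb{E}U^n_1=1/\alpha^n$, $\mathrm{sd}(U^n_1)=\sigma^n$, $\mathbb{E}V^n_1=1/\beta^n$, $\mathrm{sd}(V^n_1)=\varsigma^n$; let $N^n_s(t)=\max\{k:\sum_{i=1}^kU^n_i\le t\}$, $N^n_b(t)=\max\{k:\sum_{i=1}^kV^n_i\le t\}$; let $N^n_{sr},N^n_{br}$ be unit-rate Poisson processes, and let $X^n(0)$ be an integer-valued random variable, all four objects mutually independent. Let $\theta^n,\gamma^n>0$. The queue length $X^n$ (positive values = number of waiting sellers, negative values = minus the number of waiting buyers) is the solution of $X^n(t)=X^n(0)+N^n_s(t)-N^n_b(t)-N^n_{sr}\big(\theta^n\int_0^tX^{n,+}(s)ds\big)+N^n_{br}\big(\gamma^n\int_0^tX^{n,-}(s)ds\big)$,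 where $a^+=\max\{a,0\}$, $a^-=\max\{0,-a\}$. Standing assumptions: $\mathbb{P}(U^n_1>0)=\mathbb{P}(V^n_1>0)=1$ for all $n$; $\{(U^n_1)^2\}_n$ and $\{(V^n_1)^2\}_n$ are uniformly integrable; there exist $\alpha,\beta,\sigma,\varsigma\in(0,\infty)$ with $\alpha^n\to\alpha$, $\beta^n\to\beta$, $\sigma^n\to\sigma$, $\varsigma^n\to\varsigma$; and there exist $\theta,\gamma\in(0,\infty)$ with $n\theta^n\to\theta$, $n\gamma^n\to\gamma$. Fluid scaling: $\bar X^n(t)=X^n(nt)/n$. *)

theory Defs
  imports "HOL-Probability.Probability"
begin

text \<open>Renewal counting process built from inter-arrival times Y 0, Y 1, ...
  (the paper's Y_1, Y_2, ...): number of arrivals up to time t.\<close>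
definition renewal_count :: "(nat \<Rightarrow> 'a \<Rightarrow> real) \<Rightarrow> real \<Rightarrow> 'a \<Rightarrow> real" where
  "renewal_count Y t \<omega> = real (GREATEST k. (\<Sum>i<k. Y i \<omega>) \<le> t)"

definition gen_events :: "'a measure \<Rightarrow> ('i \<Rightarrow> 'a \<Rightarrow> real) \<Rightarrow> 'i set \<Rightarrow> 'a set set" where
  "gen_events M Y I = sigma_sets (space M) (\<Union>i\<in>I. {Y i -` A \<inter> space M | A. A \<in> sets borel})"

definition unit_poisson_process :: "'a measure \<Rightarrow> (real \<Rightarrow> 'a \<Rightarrow> real) \<Rightarrow> bool" where
  "unit_poisson_process M N \<longleftrightarrow>
     (\<forall>t\<ge>0. N t \<in> borel_measurable M) \<and>
     (AE \<omega> in M. N 0 \<omega> = 0 \<and> mono_on {0..} (\<lambda>t. N t \<omega>) \<and>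
        (\<forall>t\<ge>0. N t \<omega> \<in> \<nat> \<and> continuous (at_right t) (\<lambda>s. N s \<omega>))) \<and>
     (\<forall>s t. 0 \<le> s \<longrightarrow> s < t \<longrightarrow>
        distr M borel (\<lambda>\<omega>. N t \<omega> - N s \<omega>) = distr (measure_pmf (poisson_pmf (t - s))) borel real) \<and>
     (\<forall>ts::real list. sorted_wrt (<) ts \<longrightarrow> (\<forall>t\<in>set ts. 0 \<le> t) \<longrightarrow>
        prob_space.indep_vars M (\<lambda>_. borel) (\<lambda>i \<omega>. N (ts ! Suc i) \<omega> - N (ts ! i) \<omega>) {..<length ts - 1})"

definition unif_integrable :: "(nat \<Rightarrow> 'a measure) \<Rightarrow> (nat \<Rightarrow> 'a \<Rightarrow> real) \<Rightarrow> bool" where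
  "unif_integrable M Y \<longleftrightarrow> (\<forall>n. integrable (M n) (Y n)) \<and>
     (\<forall>e>0. \<exists>K. \<forall>n. (\<integral>\<omega>. \<bar>Y n \<omega>\<bar> * indicator {\<omega>. K < \<bar>Y n \<omega>\<bar>} \<omega> \<partial>M n) < e)"

end

theory Submission
  imports Defs
begin

text \<open>Reneging can only push the queue towards zero, so the path of \<open>X\<close> is bounded by
  \<open>\<bar>X(0)\<bar>\<close> plus the two renewal counts; for this one uses that the jumps of a Poisson process are
  almost surely of size 1. Hence on a fixed time interval the arguments of the fluid-scaled Poisson
  processes stay in a compact set as long as the scaled renewal counts are close to their means.
  By Gronwall's inequality the distance to the fluid limit is then bounded, path by path, by a
  constant times the sum of the initial error and the errors in the laws of large numbers for the
  four counting processes; when that sum is at least 1, the a priori bound gives the same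
  conclusion. Since counting processes are monotone and their limits linear, the uniform errors are
  controlled by the errors at finitely many grid points, so the theorem reduces to
  \<open>L\<^sup>1\<close> laws of large numbers at fixed times.\<close>

section \<open>Upper integrals\<close>

text \<open>The Poisson processes are read at times that depend on the queue itself, so laws of
  large numbers at fixed times do not apply to them directly. What is needed is an error bound
  uniform over a deterministic interval, and its length \<open>K\<close> must come from a bound on
  \<open>X\<close> in which the Poisson paths do not occur. That bound would fail for a clock
  jumping by 2, which could turn one waiting buyer into one waiting seller; hence unit jumps have to
  be extracted from the laws of the increments. Convergence is asserted in mean. The path estimate
  is linear in the total error, for large errors too, so it suffices that each single error tends to
  0 in mean. The limits are taken in a fixed order: for a grid of \<open>m\<close> cells
  \<open>n\<close> tends to infinity, which leaves a multiple of \<open>1 / m\<close>, and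
  \<open>m\<close> is chosen beforehand to make that multiple small.\<close>

text \<open>Neither the suprema over uncountable sets of times nor the renewal counts are known to be
  measurable, and \<^const>\<open>nn_integral\<close> is a lower integral, which is not subadditive on
  non-measurable functions; the upper integral is.\<close>

definition upper_nn_integral :: "'a measure \<Rightarrow> ('a \<Rightarrow> ennreal) \<Rightarrow> ennreal" where
  "upper_nn_integral M f = (INF g\<in>{g \<in> borel_measurable M. AE x in M. f x \<le> g x}. \<integral>\<^sup>+x. g x \<partial>M)"

lemma upper_nn_integral_le:
  assumes "g \<in> borel_measurable M" "AE x in M. f x \<le> g x"
  shows "upper_nn_integral M f \<le> (\<integral>\<^sup>+x. g x \<partial>M)"
  unfolding upper_nn_integral_def using assms by (intro INF_lower) auto

lemma upper_nn_integral_le_AE: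
  assumes "f \<in> borel_measurable M"
  shows "upper_nn_integral M f \<le> (\<integral>\<^sup>+x. f x \<partial>M)"
  using assms by (intro upper_nn_integral_le) auto

text \<open>The theorem speaks of \<open>nn_integral\<close>; estimates made for the upper integral
  return to it through this inequality.\<close>

lemma nn_integral_le_upper: "(\<integral>\<^sup>+x. f x \<partial>M) \<le> upper_nn_integral M f"
  unfolding upper_nn_integral_def by (intro INF_greatest nn_integral_mono_AE) auto

lemma upper_nn_integral_mono_AE:
  assumes "AE x in M. f x \<le> g x"
  shows "upper_nn_integral M f \<le> upper_nn_integral M g"
  unfolding upper_nn_integral_def
proof (intro INF_superset_mono subsetI)
  fix h assume "h \<in> {h \<in> borel_measurable M. AE x in M. g x \<le> h x}"
  then have "h \<in> borel_measurable M" and g: "AE x in M. g x \<le> h x" by auto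
  moreover from assms g have "AE x in M. f x \<le> h x" by eventually_elim (rule order_trans)
  ultimately show "h \<in> {h \<in> borel_measurable M. AE x in M. f x \<le> h x}" by auto
qed simp

text \<open>Take a minimizing sequence of measurable majorants; its pointwise infimum is measurable
  and, the sequence being countable, still a majorant almost everywhere. With an optimal majorant at
  hand, subadditivity needs neither an epsilon nor a separate infinite case.\<close>

lemma upper_nn_integral_attained:
  obtains g where "g \<in> borel_measurable M" "AE x in M. f x \<le> g x"
    "(\<integral>\<^sup>+x. g x \<partial>M) = upper_nn_integral M f"
proof -
  let ?B = "{g \<in> borel_measurable M. AE x in M. f x \<le> g x}"
  have "(\<lambda>_. top) \<in> ?B" by auto
  then have "(\<lambda>g. \<integral>\<^sup>+x. g x \<partial>M) ` ?B \<noteq> {}" by blast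
  from ennreal_Inf_countable_INF[OF this, folded upper_nn_integral_def] obtain a :: "nat \<Rightarrow> ennreal"
    where a: "range a \<subseteq> (\<lambda>g. \<integral>\<^sup>+x. g x \<partial>M) ` ?B"
      "upper_nn_integral M f = (INF i. a i)"
    by blast
  have "\<forall>i. \<exists>g\<in>?B. a i = (\<integral>\<^sup>+x. g x \<partial>M)" using a(1) by blast
  then obtain h where h: "\<And>i. h i \<in> ?B" "\<And>i. a i = (\<integral>\<^sup>+x. h i x \<partial>M)" by metis
  let ?g = "\<lambda>x. INF i. h i x"
  have [measurable]: "h i \<in> borel_measurable M" for i using h(1) by blast
  have g: "?g \<in> borel_measurable M" by measurable
  have "AE x in M. \<forall>i. f x \<le> h i x" using h(1) by (subst AE_all_countable) blast
  then have AE: "AE x in M. f x \<le> ?g x" by eventually_elim (auto intro: INF_greatest)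
  have "(\<integral>\<^sup>+x. ?g x \<partial>M) \<le> (INF i. a i)"
    unfolding h(2) by (intro INF_greatest nn_integral_mono INF_lower) auto
  moreover have "upper_nn_integral M f \<le> (\<integral>\<^sup>+x. ?g x \<partial>M)" by (rule upper_nn_integral_le[OF g AE])
  ultimately show ?thesis using that[OF g AE] a(2) by auto
qed

lemma upper_nn_integral_add:
  "upper_nn_integral M (\<lambda>x. f x + g x) \<le> upper_nn_integral M f + upper_nn_integral M g"
proof -
  obtain a where a [measurable]: "a \<in> borel_measurable M" and fa: "AE x in M. f x \<le> a x"
    and ia: "(\<integral>\<^sup>+x. a x \<partial>M) = upper_nn_integral M f" by (rule upper_nn_integral_attained)
  obtain b where b [measurable]: "b \<in> borel_measurable M" and gb: "AE x in M. g x \<le> b x"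
    and ib: "(\<integral>\<^sup>+x. b x \<partial>M) = upper_nn_integral M g" by (rule upper_nn_integral_attained)
  have "AE x in M. f x + g x \<le> a x + b x" using fa gb by eventually_elim (rule add_mono)
  then have "upper_nn_integral M (\<lambda>x. f x + g x) \<le> (\<integral>\<^sup>+x. a x + b x \<partial>M)"
    by (intro upper_nn_integral_le) auto
  also have "\<dots> = upper_nn_integral M f + upper_nn_integral M g"
    by (simp add: nn_integral_add ia ib)
  finally show ?thesis .
qed

lemma upper_nn_integral_0: "upper_nn_integral M (\<lambda>x. 0) = 0"
  using upper_nn_integral_le[of "\<lambda>_. 0" M "\<lambda>_. 0"] by auto

lemma upper_nn_integral_sum:
  "upper_nn_integral M (\<lambda>x. \<Sum>i\<in>A. f i x) \<le> (\<Sum>i\<in>A. upper_nn_integral M (f i))"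
proof (induction A rule: infinite_finite_induct)
  case (insert i A)
  have "upper_nn_integral M (\<lambda>x. f i x + (\<Sum>i\<in>A. f i x))
      \<le> upper_nn_integral M (f i) + upper_nn_integral M (\<lambda>x. \<Sum>i\<in>A. f i x)"
    by (rule upper_nn_integral_add)
  also have "\<dots> \<le> upper_nn_integral M (f i) + (\<Sum>i\<in>A. upper_nn_integral M (f i))"
    using insert.IH by (intro add_left_mono)
  finally show ?case using insert.hyps by simp
qed (simp_all add: upper_nn_integral_0)

lemma upper_nn_integral_cmult:
  "upper_nn_integral M (\<lambda>x. c * f x) \<le> c * upper_nn_integral M f"
proof -
  obtain a where a [measurable]: "a \<in> borel_measurable M" and fa: "AE x in M. f x \<le> a x"
    and ia: "(\<integral>\<^sup>+x. a x \<partial>M) = upper_nn_integral M f" by (rule upper_nn_integral_attained)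
  have "AE x in M. c * f x \<le> c * a x" using fa by eventually_elim (rule mult_left_mono, auto)
  then have "upper_nn_integral M (\<lambda>x. c * f x) \<le> (\<integral>\<^sup>+x. c * a x \<partial>M)"
    by (intro upper_nn_integral_le) auto
  also have "\<dots> = c * upper_nn_integral M f" by (simp add: nn_integral_cmult ia)
  finally show ?thesis .
qed

lemma (in prob_space) upper_nn_integral_const: "upper_nn_integral M (\<lambda>_. c) \<le> c"
  using upper_nn_integral_le[of "\<lambda>_. c" M "\<lambda>_. c"] emeasure_space_1 by simp

section \<open>Monotone functions near a line, and Gronwall\<close>

text \<open>Between neighbouring grid points a monotone \<open>f\<close> is caught between its two
  values there, while the line rises by only \<open>a * K / m\<close>. The sum over the grid stands
  in for the maximum because it passes through an upper integral term by term.\<close>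

lemma monotone_linear_grid:
  fixes f :: "real \<Rightarrow> real"
  assumes mono: "mono_on {0..K} f" and a: "0 \<le> a" and m: "0 < (m::nat)" and v: "v \<in> {0..K}"
  shows "\<bar>f v - a * v\<bar> \<le> (\<Sum>i\<le>m. \<bar>f (K * real i / real m) - a * (K * real i / real m)\<bar>) + a * K / real m"
proof -
  let ?s = "\<lambda>i. K * real i / real m"
  let ?e = "\<lambda>i::nat. \<bar>f (?s i) - a * ?s i\<bar>"
  have K: "0 \<le> K" using v by auto
  have single: "?e i \<le> (\<Sum>i\<le>m. ?e i)" if "i \<le> m" for i
    using that by (intro member_le_sum) auto
  have s_in: "?s i \<in> {0..K}" if "i \<le> m" for i
    using that K m by (auto simp: field_simps intro!: mult_left_mono)
  show ?thesis
  \<comment> \<open>At the right end point the cell index would be \<open>m\<close>, whose right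
    neighbour lies outside the grid. This case also absorbs \<open>K = 0\<close>, so that dividing
    by \<open>K\<close> is safe afterwards.\<close>
  proof (cases "v = K")
    case True
    then have "?s m = v" using m by simp
    with single[of m] K a show ?thesis by (auto intro!: add_increasing2)
  next
    case False
    with v have vK: "v < K" "0 \<le> v" and K0: "0 < K" by auto
    define i where "i = nat \<lfloor>v * m / K\<rfloor>"
    have "0 \<le> v * m / K" using vK m K0 by simp
    then have i: "real i \<le> v * m / K" "v * m / K < real i + 1"
      unfolding i_def by linarith+
    then have lo: "?s i \<le> v" and hi: "v \<le> ?s (Suc i)"
      using K0 m by (auto simp: field_simps)
    have "v * m < K * m" using vK m by simp
    then have "v * m / K < m" using K0 by (simp add: divide_less_eq mult.commute)
    then have "real i < m" using i(1) by linarith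
    then have im: "i < m" by simp
    have step: "?s (Suc i) = ?s i + K / m" by (simp add: field_simps add_divide_distrib)
    have "f (?s i) \<le> f v" "f v \<le> f (?s (Suc i))"
      using mono lo hi v s_in[of i] s_in[of "Suc i"] im by (auto simp: mono_on_def)
    moreover have "a * ?s i \<le> a * v" "a * v \<le> a * ?s (Suc i)" "a * ?s (Suc i) = a * ?s i + a * K / m"
      using mult_left_mono[OF lo a] mult_left_mono[OF hi a] by (simp_all only: step distrib_left times_divide_eq_right)
    moreover have "f (?s (Suc i)) - a * ?s (Suc i) \<le> (\<Sum>i\<le>m. ?e i)"
      using im by (intro order_trans[OF abs_ge_self single]) simp
    moreover have "- (f (?s i) - a * ?s i) \<le> (\<Sum>i\<le>m. ?e i)"
      using im by (intro order_trans[OF abs_ge_minus_self single]) simp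
    ultimately show ?thesis by (intro abs_leI) linarith+
  qed
qed

lemma gronwall_bounded:
  fixes D :: "real \<Rightarrow> real"
  assumes int: "set_integrable lborel {0..t} D"
    and bdd: "\<And>u. u \<in> {0..t} \<Longrightarrow> D u \<le> B"
    and nonneg: "0 \<le> E" and C: "0 < C"
    and le: "\<And>u. u \<in> {0..t} \<Longrightarrow> D u \<le> E + C * (LINT s:{0..u}|lborel. D s)"
    and u: "u \<in> {0..t}"
  shows "D u \<le> 2 * E * exp (2 * C * t)"
proof -
  \<comment> \<open>The weight halves the contribution of the integral term, so the weighted supremum is at most \<open>2 * E\<close>.\<close>
  define S where "S = (SUP u\<in>{0..t}. exp (- 2 * C * u) * D u)"
  have bdd': "bdd_above ((\<lambda>u. exp (- 2 * C * u) * D u) ` {0..t})"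
  proof (rule bdd_aboveI2)
    fix u assume u: "u \<in> {0..t}"
    have "exp (- 2 * C * u) * D u \<le> exp (- 2 * C * u) * max B 0" using bdd[OF u] by (intro mult_left_mono) auto
    also have "\<dots> \<le> 1 * max B 0" using u C by (intro mult_right_mono) (auto simp: mult_nonneg_nonneg)
    finally show "exp (- 2 * C * u) * D u \<le> max B 0" by simp
  qed
  have D_le: "D s \<le> S * exp (2 * C * s)" if "s \<in> {0..t}" for s
  proof -
    have "exp (- 2 * C * s) * D s \<le> S" unfolding S_def using that by (intro cSUP_upper bdd')
    then have "exp (2 * C * s) * (exp (- 2 * C * s) * D s) \<le> exp (2 * C * s) * S" by (intro mult_left_mono) auto
    moreover have "exp (2 * C * s) * (exp (- 2 * C * s) * D s) = D s"
      using exp_add[of "2 * C * s" "- 2 * C * s"] by (simp add: mult.assoc[symmetric])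
    ultimately show ?thesis by (simp only: mult.commute[of S])
  qed
  have "exp (- 2 * C * u) * D u \<le> E + S / 2 - S / 2 * exp (- 2 * C * u)" if u: "u \<in> {0..t}" for u
  proof -
    have exp_int: "((\<lambda>s. S * exp (2 * C * s)) has_integral (S * exp (2 * C * u) / (2 * C) - S * exp (2 * C * 0) / (2 * C))) {0..u}"
      using u C by (intro fundamental_theorem_of_calculus)
        (auto intro!: derivative_eq_intros simp: has_real_derivative_iff_has_vector_derivative[symmetric])
    have si: "set_integrable lborel {0..u} (\<lambda>s. S * exp (2 * C * s))"
      by (intro borel_integrable_atLeastAtMost' continuous_intros)
    have "(LINT s:{0..u}|lborel. D s) \<le> (LINT s:{0..u}|lborel. S * exp (2 * C * s))"
      using u by (intro set_integral_mono si set_integrable_subset[OF int] D_le) auto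
    also have "\<dots> = S * (exp (2 * C * u) - 1) / (2 * C)"
      using integral_unique[OF exp_int] unfolding set_borel_integral_eq_integral(2)[OF si]
      by (simp add: right_diff_distrib diff_divide_distrib)
    finally have "C * (LINT s:{0..u}|lborel. D s) \<le> C * (S * (exp (2 * C * u) - 1) / (2 * C))"
      using C by (intro mult_left_mono) auto
    also have "\<dots> = S / 2 * (exp (2 * C * u) - 1)" using C by (simp add: field_simps)
    finally have "D u \<le> E + S / 2 * (exp (2 * C * u) - 1)" using le[OF u] by linarith
    then have "exp (- 2 * C * u) * D u \<le> exp (- 2 * C * u) * (E + S / 2 * (exp (2 * C * u) - 1))"
      by (intro mult_left_mono) auto
    also have "\<dots> = exp (- 2 * C * u) * E + S / 2 * (exp (- 2 * C * u) * exp (2 * C * u)) - S / 2 * exp (- 2 * C * u)"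
      by (simp add: algebra_simps)
    also have "exp (- 2 * C * u) * exp (2 * C * u) = 1" using exp_add[of "- 2 * C * u" "2 * C * u"] by simp
    also have "exp (- 2 * C * u) * E \<le> 1 * E" using u C nonneg by (intro mult_right_mono) auto
    finally show ?thesis by simp
  qed
  note * = this
  have S2: "S \<le> 2 * E"
  \<comment> \<open>Dropping the last term of the weighted estimate needs \<open>S\<close>
    nonnegative. Since \<open>D\<close> is bounded above, \<open>S\<close> is a genuine supremum and
    \<open>S / 2\<close> can be absorbed.\<close>
  proof (cases "S \<le> 0")
    case True then show ?thesis using nonneg by linarith
  next
    case False
    have "S \<le> E + S / 2" unfolding S_def
    proof (rule cSUP_least)
      show "{0..t} \<noteq> {}" using u by auto
      fix u assume "u \<in> {0..t}"
      moreover have "0 \<le> S / 2 * exp (- 2 * C * u)" using False by simp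
      ultimately show "exp (- 2 * C * u) * D u \<le> E + (SUP u\<in>{0..t}. exp (- 2 * C * u) * D u) / 2"
        using *[of u] unfolding S_def[symmetric] by linarith
    qed
    then show ?thesis by simp
  qed
  have "D u \<le> S * exp (2 * C * u)" by (rule D_le[OF u])
  also have "\<dots> \<le> 2 * E * exp (2 * C * u)" using S2 by (intro mult_right_mono) auto
  also have "\<dots> \<le> 2 * E * exp (2 * C * t)" using u C nonneg by (intro mult_left_mono) auto
  finally show ?thesis .
qed

section \<open>Renewal counts\<close>

text \<open>The difference of the two sides vanishes at 0 and has derivative
  \<open>exp (- y) - 1 + y\<close>, which is nonnegative. It turns a second moment into an upper
  bound for a Laplace transform.\<close>

lemma exp_minus_le_quadratic:
  fixes x :: real assumes "0 \<le> x" shows "exp (- x) \<le> 1 - x + x\<^sup>2 / 2"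
proof -
  let ?f = "\<lambda>x::real. 1 - x + x\<^sup>2 / 2 - exp (- x)"
  have "?f 0 \<le> ?f x"
  proof (rule DERIV_nonneg_imp_nondecreasing[OF assms])
    fix y :: real assume "0 \<le> y"
    have "(?f has_real_derivative - 1 + y + exp (- y)) (at y)"
      by (auto intro!: derivative_eq_intros)
    moreover have "0 \<le> - 1 + y + exp (- y)" using exp_ge_add_one_self[of "- y"] by simp
    ultimately show "\<exists>d. (?f has_real_derivative d) (at y) \<and> 0 \<le> d" by blast
  qed
  then show ?thesis by simp
qed

section \<open>Partial sums of a renewal sequence and their Laplace transforms\<close>

locale renewal_sequence = prob_space +
  fixes Y :: "nat \<Rightarrow> 'a \<Rightarrow> real"
  assumes indep: "indep_vars (\<lambda>_. borel) Y UNIV"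
    and ident: "\<And>k. distr M borel (Y k) = distr M borel (Y 0)"
    and pos0: "AE \<omega> in M. 0 < Y 0 \<omega>"
    and sq_integrable: "integrable M (\<lambda>\<omega>. (Y 0 \<omega>)\<^sup>2)"
begin

definition partial_sum :: "nat \<Rightarrow> 'a \<Rightarrow> real" where
  "partial_sum k \<omega> = (\<Sum>i<k. Y i \<omega>)"

definition mean :: real where "mean = expectation (Y 0)"

definition laplace :: "real \<Rightarrow> real" where
  "laplace l = expectation (\<lambda>\<omega>. exp (- l * Y 0 \<omega>))"

lemma Y_measurable [measurable]: "Y k \<in> borel_measurable M"
  using indep unfolding indep_vars_def by auto

lemma partial_sum_measurable [measurable]: "partial_sum k \<in> borel_measurable M"
  unfolding partial_sum_def by measurable

lemma AE_pos: "AE \<omega> in M. \<forall>k. 0 < Y k \<omega>"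
proof (subst AE_all_countable, intro allI)
  fix k
  have "(AE y in distr M borel (Y k). 0 < y) \<longleftrightarrow> (AE y in distr M borel (Y 0). 0 < y)"
    by (subst ident[of k]) (rule refl)
  then show "AE \<omega> in M. 0 < Y k \<omega>"
    using pos0 AE_distr_iff[of "Y k" M borel "\<lambda>y. 0 < y"] AE_distr_iff[of "Y 0" M borel "\<lambda>y. 0 < y"] by simp
qed

lemma integral_Y:
  assumes "f \<in> borel_measurable borel"
  shows "expectation (\<lambda>\<omega>. f (Y k \<omega>)) = (expectation (\<lambda>\<omega>. f (Y 0 \<omega>)) :: real)"
  using integral_distr[of "Y k" M borel f] integral_distr[of "Y 0" M borel f] assms
  by (simp add: ident[of k])

lemma integrable_Y:
  fixes f :: "real \<Rightarrow> real"
  assumes "f \<in> borel_measurable borel" "integrable M (\<lambda>\<omega>. f (Y 0 \<omega>))"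
  shows "integrable M (\<lambda>\<omega>. f (Y k \<omega>))"
  using integrable_distr_eq[of "Y k" M borel f] integrable_distr_eq[of "Y 0" M borel f] assms
  by (simp add: ident[of k])

lemma Y0_integrable: "integrable M (Y 0)"
  by (rule square_integrable_imp_integrable[OF _ sq_integrable]) simp

lemma mean_pos: "0 < mean"
  unfolding mean_def using pos0 Y0_integrable by (intro expectation_greater)

lemma exp_integrable:
  assumes "0 \<le> l" shows "integrable M (\<lambda>\<omega>. exp (- l * Y k \<omega>))"
proof (rule integrable_const_bound[where B = 1])
  show "AE \<omega> in M. norm (exp (- l * Y k \<omega>)) \<le> 1"
    using AE_pos by eventually_elim (simp add: assms less_imp_le)
qed simp

lemma laplace_nonneg: "0 \<le> laplace l"
  unfolding laplace_def by simp

lemma laplace_less_1: "0 < l \<Longrightarrow> laplace l < 1"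
  unfolding laplace_def
  by (intro expectation_less exp_integrable) (use pos0 in \<open>auto elim!: eventually_mono\<close>)

lemma laplace_le:
  assumes "0 \<le> l"
  shows "laplace l \<le> 1 - l * mean + l\<^sup>2 / 2 * expectation (\<lambda>\<omega>. (Y 0 \<omega>)\<^sup>2)"
proof -
  have "laplace l \<le> expectation (\<lambda>\<omega>. 1 - l * Y 0 \<omega> + l\<^sup>2 / 2 * (Y 0 \<omega>)\<^sup>2)"
    unfolding laplace_def
  proof (intro integral_mono_AE exp_integrable assms)
    show "integrable M (\<lambda>\<omega>. 1 - l * Y 0 \<omega> + l\<^sup>2 / 2 * (Y 0 \<omega>)\<^sup>2)"
      using Y0_integrable sq_integrable by auto
    show "AE \<omega> in M. exp (- l * Y 0 \<omega>) \<le> 1 - l * Y 0 \<omega> + l\<^sup>2 / 2 * (Y 0 \<omega>)\<^sup>2"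
      using pos0
    proof eventually_elim
      case (elim \<omega>)
      then show ?case using exp_minus_le_quadratic[of "l * Y 0 \<omega>"] assms by (simp add: power_mult_distrib)
    qed
  qed
  also have "\<dots> = 1 - l * mean + l\<^sup>2 / 2 * expectation (\<lambda>\<omega>. (Y 0 \<omega>)\<^sup>2)"
    using Y0_integrable sq_integrable by (simp add: mean_def prob_space)
  finally show ?thesis .
qed

lemma nn_integral_exp_partial_sum:
  assumes "0 \<le> l"
  shows "(\<integral>\<^sup>+\<omega>. ennreal (exp (- l * partial_sum k \<omega>)) \<partial>M) = ennreal (laplace l ^ k)"
proof -
  have eq: "exp (- l * partial_sum k \<omega>) = (\<Prod>i<k. exp (- l * Y i \<omega>))" for \<omega>
    by (simp add: partial_sum_def exp_sum[symmetric] sum_distrib_left sum_negf)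
  have ind: "indep_vars (\<lambda>_. borel) (\<lambda>i \<omega>. exp (- l * Y i \<omega>)) {..<k}"
    by (rule indep_vars_compose2[OF indep_vars_subset[OF indep]]) auto
  have int: "integrable M (\<lambda>\<omega>. \<Prod>i<k. exp (- l * Y i \<omega>))"
    by (rule indep_vars_integrable[OF _ ind]) (use exp_integrable[OF assms] in auto)
  have "expectation (\<lambda>\<omega>. \<Prod>i<k. exp (- l * Y i \<omega>)) = (\<Prod>i<k. expectation (\<lambda>\<omega>. exp (- l * Y i \<omega>)))"
    by (rule indep_vars_lebesgue_integral[OF _ ind]) (use exp_integrable[OF assms] in auto)
  also have "\<dots> = (\<Prod>i<k. laplace l)"
    unfolding laplace_def by (intro prod.cong refl integral_Y) simp
  finally show ?thesis
    unfolding eq using int by (subst nn_integral_eq_integral) (auto intro!: prod_nonneg)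
qed

text \<open>By independence the expected weights form a geometric series with ratio
  \<open>laplace l\<close>, which is below 1 because inter-arrival times are almost surely positive.
  With \<open>k = 0\<close> it shows that counts are finite; with \<open>k\<close> above the mean
  count it bounds their upper tail.\<close>

lemma nn_integral_suminf_exp:
  assumes "0 < l"
  shows "(\<integral>\<^sup>+\<omega>. (\<Sum>j. ennreal (exp (l * (T - partial_sum (k + j) \<omega>)))) \<partial>M)
    = ennreal (exp (l * T) * laplace l ^ k / (1 - laplace l))"
proof -
  have "(\<integral>\<^sup>+\<omega>. (\<Sum>j. ennreal (exp (l * (T - partial_sum (k + j) \<omega>)))) \<partial>M)
      = (\<Sum>j. \<integral>\<^sup>+\<omega>. ennreal (exp (l * (T - partial_sum (k + j) \<omega>))) \<partial>M)"
    by (intro nn_integral_suminf) simp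
  also have "\<dots> = (\<Sum>j. ennreal (exp (l * T) * laplace l ^ k * laplace l ^ j))"
  proof (rule suminf_cong)
    fix j
    have "exp (l * (T - partial_sum (k + j) \<omega>)) = exp (l * T) * exp (- l * partial_sum (k + j) \<omega>)" for \<omega>
      by (simp add: exp_add[symmetric] algebra_simps)
    then have "(\<integral>\<^sup>+\<omega>. ennreal (exp (l * (T - partial_sum (k + j) \<omega>))) \<partial>M)
      = (\<integral>\<^sup>+\<omega>. ennreal (exp (l * T)) * ennreal (exp (- l * partial_sum (k + j) \<omega>)) \<partial>M)"
      by (simp only: ennreal_mult' exp_ge_zero)
    also have "\<dots> = ennreal (exp (l * T)) * (\<integral>\<^sup>+\<omega>. ennreal (exp (- l * partial_sum (k + j) \<omega>)) \<partial>M)"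
      by (rule nn_integral_cmult) measurable
    also have "\<dots> = ennreal (exp (l * T)) * ennreal (laplace l ^ (k + j))"
      using assms by (subst nn_integral_exp_partial_sum) auto
    also have "\<dots> = ennreal (exp (l * T) * laplace l ^ k * laplace l ^ j)"
      by (subst ennreal_mult'[symmetric]) (simp_all add: power_add mult.assoc)
    finally show "(\<integral>\<^sup>+\<omega>. ennreal (exp (l * (T - partial_sum (k + j) \<omega>))) \<partial>M)
      = ennreal (exp (l * T) * laplace l ^ k * laplace l ^ j)" .
  qed
  also have "\<dots> = ennreal (exp (l * T) * laplace l ^ k * (1 / (1 - laplace l)))"
    using laplace_nonneg laplace_less_1[OF assms]
    by (intro suminf_ennreal_eq sums_mult geometric_sums) auto
  finally show ?thesis by simp
qed

text \<open>Without finiteness \<open>GREATEST\<close> carries no information. A nonnegative series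
  with finite expectation converges almost surely, so its terms
  \<open>exp (- partial_sum j \<omega>)\<close> tend to 0 and the partial sums to infinity; one null
  set serves all \<open>T\<close>.\<close>

lemma AE_finite_partial_sums: "AE \<omega> in M. \<forall>T. finite {k. partial_sum k \<omega> \<le> T}"
proof -
  let ?h = "\<lambda>\<omega>. \<Sum>j. ennreal (exp (1 * (0 - partial_sum (0 + j) \<omega>)))"
  have "(\<integral>\<^sup>+\<omega>. ?h \<omega> \<partial>M) \<noteq> \<infinity>" 
    by (subst nn_integral_suminf_exp) (simp_all only: zero_less_one infinity_ennreal_def ennreal_neq_top not_False_eq_True)
  then have "AE \<omega> in M. ?h \<omega> \<noteq> \<infinity>" by (intro nn_integral_PInf_AE) measurable
  then show ?thesis
  proof eventually_elim
    case (elim \<omega>)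
    show ?case
    proof
      fix T
      have "summable (\<lambda>j. exp (- partial_sum j \<omega>))"
        by (rule summable_suminf_not_top) (use elim in simp_all)
      then have "(\<lambda>j. exp (- partial_sum j \<omega>)) \<longlonglongrightarrow> 0" by (rule summable_LIMSEQ_zero)
      then have "eventually (\<lambda>j. exp (- partial_sum j \<omega>) < exp (- T)) sequentially"
        by (rule order_tendstoD) simp
      then obtain J where J: "\<And>j. j \<ge> J \<Longrightarrow> T < partial_sum j \<omega>"
        by (auto simp: eventually_sequentially)
      have "{k. partial_sum k \<omega> \<le> T} \<subseteq> {..<J}" using J by (force simp: not_le[symmetric])
      then show "finite {k. partial_sum k \<omega> \<le> T}" by (rule finite_subset) simp
    qed
  qed
qed

section \<open>Paths and mean deviation of the renewal count\<close>

definition regular :: "'a \<Rightarrow> bool" where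
  "regular \<omega> \<longleftrightarrow> (\<forall>k. 0 < Y k \<omega>) \<and> (\<forall>T. finite {k. partial_sum k \<omega> \<le> T})"

lemma AE_regular: "AE \<omega> in M. regular \<omega>"
  using AE_pos AE_finite_partial_sums by eventually_elim (simp add: regular_def)

text \<open>The set inside \<open>GREATEST\<close> is nonempty because \<open>T\<close> is
  nonnegative, bounded by regularity, and downward closed because partial sums increase. Thus
  statements about counts become statements about partial sums.\<close>

lemma renewal_count_nat:
  assumes "regular \<omega>" "0 \<le> T"
  shows "\<exists>N. renewal_count Y T \<omega> = real N \<and> (\<forall>k. partial_sum k \<omega> \<le> T \<longleftrightarrow> k \<le> N)"
proof -
  define P where "P k \<longleftrightarrow> partial_sum k \<omega> \<le> T" for k
  have fin: "finite {k. P k}" using assms unfolding regular_def P_def by blast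
  then obtain b where b: "\<And>k. P k \<Longrightarrow> k \<le> b"
    using finite_nat_set_iff_bounded_le[of "{k. P k}"] by auto
  have P0: "P 0" using assms by (simp add: P_def partial_sum_def)
  define N where "N = (GREATEST k. P k)"
  have PN: "P N" unfolding N_def using P0 b by (rule GreatestI_nat)
  have le: "P k \<Longrightarrow> k \<le> N" for k unfolding N_def using b by (intro Greatest_le_nat)
  have mono: "partial_sum j \<omega> \<le> partial_sum k \<omega>" if "j \<le> k" for j k
    using assms that unfolding partial_sum_def regular_def
    by (intro sum_mono2) (auto intro: less_imp_le)
  have iff: "partial_sum k \<omega> \<le> T \<longleftrightarrow> k \<le> N" for k
    using le[of k] PN mono[of k N] unfolding P_def by auto
  have "renewal_count Y T \<omega> = real N"
    unfolding renewal_count_def N_def P_def partial_sum_def ..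
  then show ?thesis using iff by blast
qed

lemma renewal_count_mono:
  assumes "regular \<omega>" "0 \<le> S" "S \<le> T"
  shows "renewal_count Y S \<omega> \<le> renewal_count Y T \<omega>"
proof -
  obtain N where N: "renewal_count Y S \<omega> = real N" "\<And>k. partial_sum k \<omega> \<le> S \<longleftrightarrow> k \<le> N"
    using renewal_count_nat[OF assms(1,2)] by blast
  obtain N' where N': "renewal_count Y T \<omega> = real N'" "\<And>k. partial_sum k \<omega> \<le> T \<longleftrightarrow> k \<le> N'"
    using renewal_count_nat[OF assms(1), of T] assms(2,3) by force
  have "partial_sum N \<omega> \<le> S" using N(2) by blast
  then have "N \<le> N'" using N'(2) assms(3) by (meson order_trans)
  then show ?thesis using N N' by simp
qed

text \<open>The excess of the count over \<open>k\<close> is the number of \<open>j > k\<close> with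
  \<open>partial_sum j \<omega> \<le> T\<close>. Exponential weights give a geometric series in expectation, whereas
  Chebyshev bounds on these events decay only like \<open>1 / j\<close>.\<close>

lemma renewal_count_upper_path:
  assumes "regular \<omega>" "0 \<le> T" "0 \<le> l"
  shows "ennreal (renewal_count Y T \<omega> - real k) \<le> (\<Sum>j. ennreal (exp (l * (T - partial_sum (k + j) \<omega>))))"
proof -
  obtain N where N: "renewal_count Y T \<omega> = real N" "\<And>k. partial_sum k \<omega> \<le> T \<longleftrightarrow> k \<le> N"
    using renewal_count_nat[OF assms(1,2)] by blast
  have "ennreal (real N - real k) = ennreal (real (N - k))"
    by (cases "N \<le> k") (auto simp: of_nat_diff ennreal_neg)
  also have "\<dots> = (\<Sum>j<N - k. 1 :: ennreal)" by (simp add: ennreal_of_nat_eq_real_of_nat)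
  \<comment> \<open>The indices from \<open>k\<close> to \<open>N - 1\<close> replace those from
    \<open>k + 1\<close> to \<open>N\<close>: there are equally many, and their partial sums are
    also at most \<open>T\<close>.\<close>
  also have "\<dots> \<le> (\<Sum>j<N - k. ennreal (exp (l * (T - partial_sum (k + j) \<omega>))))"
  proof (rule sum_mono)
    fix j assume "j \<in> {..<N - k}"
    then have "partial_sum (k + j) \<omega> \<le> T" using N(2) by auto
    then have "1 \<le> exp (l * (T - partial_sum (k + j) \<omega>))" using assms by simp
    then show "1 \<le> ennreal (exp (l * (T - partial_sum (k + j) \<omega>)))"
      using ennreal_leI[of 1] by (simp add: ennreal_1)
  qed
  also have "\<dots> \<le> (\<Sum>j. ennreal (exp (l * (T - partial_sum (k + j) \<omega>))))"
    by (intro sum_le_suminf) auto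
  finally show ?thesis using N by simp
qed

text \<open>A pathwise Chebyshev inequality. The deficit is at most \<open>k\<close>, and it is
  positive only if \<open>partial_sum k \<omega>\<close> exceeds \<open>T\<close>, that is, if its
  deviation from \<open>k * mean\<close> exceeds the positive gap \<open>T - k * mean\<close>. As
  the deficit is bounded, a second moment suffices here.\<close>

lemma renewal_count_lower_path:
  assumes "regular \<omega>" "0 \<le> T" "k * mean < T"
  shows "real k - renewal_count Y T \<omega> \<le> k / (T - k * mean)\<^sup>2 * (partial_sum k \<omega> - k * mean)\<^sup>2"
proof -
  obtain N where N: "renewal_count Y T \<omega> = real N" "\<And>k. partial_sum k \<omega> \<le> T \<longleftrightarrow> k \<le> N"
    using renewal_count_nat[OF assms(1,2)] by blast
  show ?thesis
  proof (cases "k \<le> N")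
    case True
    then have "real k - renewal_count Y T \<omega> \<le> 0" using N by simp
    also have "0 \<le> k / (T - k * mean)\<^sup>2 * (partial_sum k \<omega> - k * mean)\<^sup>2" by simp
    finally show ?thesis .
  next
    case False
    then have "T < partial_sum k \<omega>" using N(2)[of k] by auto
    then have "(T - k * mean)\<^sup>2 \<le> (partial_sum k \<omega> - k * mean)\<^sup>2"
      using assms(3) by (intro power_mono) auto
    then have "real k * 1 \<le> real k * ((partial_sum k \<omega> - k * mean)\<^sup>2 / (T - k * mean)\<^sup>2)"
      using assms(3) by (intro mult_left_mono) (auto simp: le_divide_eq)
    then show ?thesis using N by simp
  qed
qed

lemma partial_sum_variance:
  "integrable M (\<lambda>\<omega>. (partial_sum k \<omega> - k * mean)\<^sup>2)"
  "expectation (\<lambda>\<omega>. (partial_sum k \<omega> - k * mean)\<^sup>2) = k * variance (Y 0)"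
proof -
  let ?Z = "\<lambda>i \<omega>. Y i \<omega> - mean"
  have Z_int: "integrable M (?Z i)" for i
    using integrable_Y[of "\<lambda>y. y"] Y0_integrable by auto
  have Z_mean: "expectation (?Z i) = 0" for i
    using integral_Y[of "\<lambda>y. y - mean" i] Y0_integrable by (simp add: mean_def prob_space)
  have Z_sq: "integrable M (\<lambda>\<omega>. ?Z i \<omega> * ?Z i \<omega>)" for i
  proof -
    have "integrable M (\<lambda>\<omega>. (Y 0 \<omega>)\<^sup>2 - 2 * mean * Y 0 \<omega> + mean\<^sup>2)"
      using Y0_integrable sq_integrable by auto
    also have "(\<lambda>\<omega>. (Y 0 \<omega>)\<^sup>2 - 2 * mean * Y 0 \<omega> + mean\<^sup>2) = (\<lambda>\<omega>. (Y 0 \<omega> - mean) * (Y 0 \<omega> - mean))"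
      by (auto simp: power2_eq_square algebra_simps)
    finally show ?thesis using integrable_Y[of "\<lambda>y. (y - mean) * (y - mean)" i] by simp
  qed
  have Z_var: "expectation (\<lambda>\<omega>. ?Z i \<omega> * ?Z i \<omega>) = variance (Y 0)" for i
    using integral_Y[of "\<lambda>y. (y - mean) * (y - mean)" i] by (simp add: mean_def power2_eq_square)
  have off: "integrable M (\<lambda>\<omega>. ?Z i \<omega> * ?Z j \<omega>)" "expectation (\<lambda>\<omega>. ?Z i \<omega> * ?Z j \<omega>) = 0" if "i \<noteq> j" for i j
  proof -
    have ind: "indep_vars (\<lambda>_. borel) ?Z {i, j}"
      by (rule indep_vars_compose2[OF indep_vars_subset[OF indep]]) auto
    have "(\<lambda>\<omega>. \<Prod>k\<in>{i,j}. ?Z k \<omega>) = (\<lambda>\<omega>. ?Z i \<omega> * ?Z j \<omega>)" using that by auto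
    with indep_vars_integrable[OF _ ind] indep_vars_lebesgue_integral[OF _ ind] Z_int Z_mean that
    show "integrable M (\<lambda>\<omega>. ?Z i \<omega> * ?Z j \<omega>)" "expectation (\<lambda>\<omega>. ?Z i \<omega> * ?Z j \<omega>) = 0"
      by auto
  qed
  have ZZ: "integrable M (\<lambda>\<omega>. ?Z i \<omega> * ?Z j \<omega>)" for i j using off Z_sq by (cases "i = j") auto
  have E: "expectation (\<lambda>\<omega>. ?Z i \<omega> * ?Z j \<omega>) = (if i = j then variance (Y 0) else 0)" for i j
    using off Z_var by auto
  have eq: "(partial_sum k \<omega> - k * mean)\<^sup>2 = (\<Sum>i<k. \<Sum>j<k. ?Z i \<omega> * ?Z j \<omega>)" for \<omega>
  proof -
    have "partial_sum k \<omega> - k * mean = (\<Sum>i<k. ?Z i \<omega>)" by (simp add: partial_sum_def sum_subtractf)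
    then show ?thesis by (simp add: power2_eq_square sum_product)
  qed
  show "integrable M (\<lambda>\<omega>. (partial_sum k \<omega> - k * mean)\<^sup>2)"
    unfolding eq using ZZ by auto
  show "expectation (\<lambda>\<omega>. (partial_sum k \<omega> - k * mean)\<^sup>2) = k * variance (Y 0)"
    unfolding eq using ZZ by (simp add: Bochner_Integration.integral_sum E)
qed

text \<open>The target \<open>a\<close> lies between \<open>k2\<close> and \<open>k1\<close>, so the
  error splits into the width \<open>k1 - k2\<close>, the excess over \<open>k1\<close> and the
  deficit below \<open>k2\<close>. The condition \<open>l * T \<le> r * k1\<close> gives
  \<open>exp (l * T) * laplace l ^ k1 \<le> 1\<close>, so that only the factor \<open>1 / r\<close>
  of the geometric series remains. For \<open>k2 = 0\<close> there is no deficit.\<close>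

lemma renewal_count_L1_bound:
  fixes k1 k2 :: nat and T l r a :: real
  assumes T: "0 \<le> T" and l: "0 < l" and r: "0 < r" "laplace l \<le> 1 - r" "l * T \<le> r * k1"
    and k2: "k2 = 0 \<or> k2 * mean < T" and a: "real k2 \<le> a" "a \<le> real k1"
  shows "upper_nn_integral M (\<lambda>\<omega>. ennreal \<bar>renewal_count Y T \<omega> - a\<bar>)
    \<le> ennreal (real k1 - real k2) + ennreal (1 / r) + ennreal (k2\<^sup>2 * variance (Y 0) / (T - k2 * mean)\<^sup>2)"
proof -
  let ?u = "\<lambda>\<omega>. \<Sum>j. ennreal (exp (l * (T - partial_sum (k1 + j) \<omega>)))"
  let ?v = "\<lambda>\<omega>. ennreal (k2 / (T - k2 * mean)\<^sup>2 * (partial_sum k2 \<omega> - k2 * mean)\<^sup>2)"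
  have "AE \<omega> in M. ennreal \<bar>renewal_count Y T \<omega> - a\<bar> \<le> ennreal (real k1 - real k2) + ?u \<omega> + ?v \<omega>"
    using AE_regular
  proof eventually_elim
    case (elim \<omega>)
    let ?N = "renewal_count Y T \<omega>"
    obtain N where N: "?N = real N" using renewal_count_nat[OF elim T] by blast
    have "\<bar>?N - a\<bar> \<le> (real k1 - k2) + max 0 (?N - k1) + max 0 (k2 - ?N)" using a by auto
    then have "ennreal \<bar>?N - a\<bar> \<le> ennreal ((real k1 - k2) + max 0 (?N - k1) + max 0 (k2 - ?N))"
      by (rule ennreal_leI)
    also have "\<dots> = ennreal (real k1 - real k2) + ennreal (?N - k1) + ennreal (k2 - ?N)"
      using a by (simp add: ennreal_plus max_def ennreal_neg)
    also have "\<dots> \<le> ennreal (real k1 - real k2) + ?u \<omega> + ?v \<omega>"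
    proof (intro add_mono order_refl)
    show "ennreal (?N - k1) \<le> ?u \<omega>"
      using l by (intro renewal_count_upper_path elim T) simp
    show "ennreal (k2 - ?N) \<le> ?v \<omega>"
    proof (cases "k2 = 0")
      case False
      then show ?thesis using k2 by (intro ennreal_leI renewal_count_lower_path elim T) simp
    qed (simp add: N ennreal_neg)
    qed
    finally show ?case .
  qed
  then have "upper_nn_integral M (\<lambda>\<omega>. ennreal \<bar>renewal_count Y T \<omega> - a\<bar>)
      \<le> (\<integral>\<^sup>+\<omega>. ennreal (real k1 - real k2) + ?u \<omega> + ?v \<omega> \<partial>M)"
    by (intro upper_nn_integral_le) measurable
  also have "\<dots> = ennreal (real k1 - real k2) + (\<integral>\<^sup>+\<omega>. ?u \<omega> \<partial>M) + (\<integral>\<^sup>+\<omega>. ?v \<omega> \<partial>M)"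
    by (subst nn_integral_add, measurable, subst nn_integral_add) (simp_all add: emeasure_space_1)
  also have "\<dots> \<le> ennreal (real k1 - real k2) + ennreal (1 / r) + ennreal (k2\<^sup>2 * variance (Y 0) / (T - k2 * mean)\<^sup>2)"
  proof (intro add_mono order_refl)
  show "(\<integral>\<^sup>+\<omega>. ?u \<omega> \<partial>M) \<le> ennreal (1 / r)"
  proof -
    have "laplace l ^ k1 \<le> exp (- r) ^ k1"
      using r(2) exp_ge_add_one_self[of "- r"] laplace_nonneg by (intro power_mono) auto
    also have "\<dots> = exp (- r * k1)" by (simp add: exp_of_nat_mult[symmetric] mult.commute)
    finally have "exp (l * T) * laplace l ^ k1 \<le> exp (l * T) * exp (- r * k1)" by simp
    also have "\<dots> \<le> 1" using r(3) by (simp add: exp_add[symmetric])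
    finally have "exp (l * T) * laplace l ^ k1 / (1 - laplace l) \<le> 1 / r"
      using r laplace_nonneg[of l] by (intro frac_le) auto
    then show ?thesis by (subst nn_integral_suminf_exp[OF l]) (rule ennreal_leI)
  qed
  show "(\<integral>\<^sup>+\<omega>. ?v \<omega> \<partial>M) \<le> ennreal (k2\<^sup>2 * variance (Y 0) / (T - k2 * mean)\<^sup>2)"
  proof -
    have "(\<integral>\<^sup>+\<omega>. ?v \<omega> \<partial>M)
        = ennreal (expectation (\<lambda>\<omega>. k2 / (T - k2 * mean)\<^sup>2 * (partial_sum k2 \<omega> - k2 * mean)\<^sup>2))"
      by (intro nn_integral_eq_integral integrable_mult_right partial_sum_variance) simp
    also have "\<dots> = ennreal (k2\<^sup>2 * variance (Y 0) / (T - k2 * mean)\<^sup>2)"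
      by (subst integral_mult_right_zero, subst partial_sum_variance(2)) (simp add: power2_eq_square)
    finally show ?thesis by (rule eq_refl)
  qed
  qed
  finally show ?thesis .
qed

end

section \<open>Law of large numbers in mean for a sequence of renewal processes\<close>

lemma tendsto_ennreal_zeroI:
  fixes f :: "'b \<Rightarrow> ennreal"
  assumes "\<And>e. 0 < e \<Longrightarrow> eventually (\<lambda>x. f x \<le> ennreal e) F"
  shows "(f \<longlongrightarrow> 0) F"
proof (rule order_tendstoI)
  fix a :: ennreal assume "0 < a"
  then obtain b where b: "0 < b" "b < a" using dense by blast
  then have "b < top" by (metis less_top not_less_iff_gr_or_eq order.strict_trans top.not_eq_extremum)
  then obtain e where e: "b = ennreal e" "0 \<le> e" by (auto simp: less_top_ennreal)
  with b have "0 < e" by auto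
  from assms[OF this] show "eventually (\<lambda>x. f x < a) F"
    by eventually_elim (use b e in auto)
qed simp

lemma upper_nn_integral_scale_le:
  assumes "upper_nn_integral M (\<lambda>\<omega>. ennreal \<bar>f \<omega> - c * a\<bar>) \<le> ennreal B" "0 < c" "0 \<le> B"
  shows "upper_nn_integral M (\<lambda>\<omega>. ennreal \<bar>f \<omega> / c - a\<bar>) \<le> ennreal (B / c)"
proof -
  have "\<bar>f \<omega> / c - a\<bar> = 1 / c * \<bar>f \<omega> - c * a\<bar>" for \<omega>
  proof -
    have "f \<omega> / c - a = 1 / c * (f \<omega> - c * a)" using assms(2) by (simp add: field_simps)
    then show ?thesis using assms(2) by (simp add: abs_mult)
  qed
  then have "upper_nn_integral M (\<lambda>\<omega>. ennreal \<bar>f \<omega> / c - a\<bar>)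
      = upper_nn_integral M (\<lambda>\<omega>. ennreal (1 / c) * ennreal \<bar>f \<omega> - c * a\<bar>)"
    using assms(2) by (simp only: ennreal_mult' abs_ge_zero ennreal_mult zero_le_divide_1_iff less_imp_le)
  also have "\<dots> \<le> ennreal (1 / c) * upper_nn_integral M (\<lambda>\<omega>. ennreal \<bar>f \<omega> - c * a\<bar>)"
    by (rule upper_nn_integral_cmult)
  also have "\<dots> \<le> ennreal (1 / c) * ennreal B" using assms(1) by (rule mult_left_mono) simp
  also have "\<dots> = ennreal (B / c)" using assms by (subst ennreal_mult[symmetric]) auto
  finally show ?thesis .
qed

lemma renewal_count_LLN:
  fixes M :: "nat \<Rightarrow> 'a measure" and Y :: "nat \<Rightarrow> nat \<Rightarrow> 'a \<Rightarrow> real"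
  assumes Y: "\<And>n. renewal_sequence (M n) (Y n)"
    and mean: "(\<lambda>n. \<integral>\<omega>. Y n 0 \<omega> \<partial>M n) \<longlonglongrightarrow> \<mu>" and \<mu>: "0 < \<mu>"
    and var: "(\<lambda>n. prob_space.variance (M n) (Y n 0)) \<longlonglongrightarrow> v" and v: "0 \<le> v"
    and u: "0 \<le> u"
  shows "(\<lambda>n. upper_nn_integral (M n) (\<lambda>\<omega>. ennreal \<bar>renewal_count (Y n) (real n * u) \<omega> / real n - u / \<mu>\<bar>))
    \<longlonglongrightarrow> 0"
proof (rule tendsto_ennreal_zeroI)
  fix e :: real assume e: "0 < e"
  define mn where "mn n = (\<integral>\<omega>. Y n 0 \<omega> \<partial>M n)" for n
  define vn where "vn n = prob_space.variance (M n) (Y n 0)" for n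
  define d where "d = e / 4"
  have d: "0 < d" using e by (simp add: d_def)
  define a where "a = u / \<mu>"
  have a: "0 \<le> a" "a * \<mu> = u" using u \<mu> by (auto simp: a_def)
  define m2 where "m2 = v + \<mu>\<^sup>2"
  have m2: "0 < m2" using v \<mu> by (simp add: m2_def add_nonneg_pos)
  \<comment> \<open>This \<open>l\<close> maximizes
    \<open>(a + d) * (l * \<mu> - l\<^sup>2 / 2 * m2) - l * u\<close>, the exponential rate gained
    by aiming at \<open>(a + d) * n\<close> arrivals; \<open>m2\<close> is the limit of the second
    moments. The maximum is \<open>l * d * \<mu> / 2\<close>.\<close>
  define l where "l = d * \<mu> / ((a + d) * m2)"
  have l: "0 < l" using d a \<mu> m2 by (simp add: l_def)
  \<comment> \<open>Only half of the available surplus \<open>d * \<mu> / 2\<close> is claimed. The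
    bound \<open>laplace l \<le> 1 - r\<close> thus holds with strict inequality in the limit and
    survives for large \<open>n\<close>.\<close>
  define r where "r = l * (u + d * \<mu> / 4) / (a + d)"
  have r: "0 < r" using l u d \<mu> a by (simp add: r_def add_nonneg_pos)
  have ad: "0 < a + d" using a d by simp
  have r_lim: "r < l * \<mu> - l\<^sup>2 / 2 * m2"
  proof -
    have lm: "l * ((a + d) * m2) = d * \<mu>" using ad m2 by (simp add: l_def)
    have "(a + d) * (l * \<mu> - l\<^sup>2 / 2 * m2) = l * (a * \<mu> + d * \<mu> - l * ((a + d) * m2) / 2)"
      by (simp add: power2_eq_square algebra_simps)
    also have "\<dots> = l * (u + d * \<mu> / 2)" using a lm by (simp add: algebra_simps)
    also have "\<dots> > l * (u + d * \<mu> / 4)" using l d \<mu> by simp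
    finally show ?thesis unfolding r_def using ad by (simp add: pos_divide_less_eq mult.commute)
  qed
  have "(\<lambda>n. l * mn n - l\<^sup>2 / 2 * (vn n + (mn n)\<^sup>2)) \<longlonglongrightarrow> l * \<mu> - l\<^sup>2 / 2 * m2"
    unfolding m2_def mn_def vn_def by (intro tendsto_intros mean var)
  then have ev1: "eventually (\<lambda>n. r < l * mn n - l\<^sup>2 / 2 * (vn n + (mn n)\<^sup>2)) sequentially"
    using r_lim by (rule order_tendstoD)
  have "(\<lambda>n. (a - d) * mn n) \<longlonglongrightarrow> (a - d) * \<mu>" unfolding mn_def by (intro tendsto_intros mean)
  moreover have "(a - d) * \<mu> < u - d * \<mu> / 2" using a d \<mu> by (simp add: algebra_simps)
  ultimately have ev2: "eventually (\<lambda>n. (a - d) * mn n < u - d * \<mu> / 2) sequentially"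
    by (rule order_tendstoD)
  have ev3: "eventually (\<lambda>n. vn n < v + 1) sequentially"
    unfolding vn_def using var by (rule order_tendstoD) simp
  \<comment> \<open>The 2 pays for rounding \<open>k1\<close> and \<open>k2\<close>. In the
    Chebyshev term both \<open>k2\<^sup>2\<close> and the squared gap are of order
    \<open>n\<^sup>2\<close>, so it stays bounded. The total error is at most
    \<open>2 * d * n + C\<close>, which after division by \<open>n\<close> is below
    \<open>3 * d\<close>, hence below \<open>e\<close>.\<close>
  define C where "C = 2 + 1 / r + a\<^sup>2 * (v + 1) / (d * \<mu> / 2)\<^sup>2"
  have C: "0 \<le> C" using r v by (simp add: C_def)
  have "(\<lambda>n. C / real n) \<longlonglongrightarrow> 0" by (rule lim_const_over_n)
  then have ev4: "eventually (\<lambda>n. C / real n < d) sequentially" using d by (rule order_tendstoD)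
  show "eventually (\<lambda>n. upper_nn_integral (M n)
      (\<lambda>\<omega>. ennreal \<bar>renewal_count (Y n) (real n * u) \<omega> / real n - u / \<mu>\<bar>) \<le> ennreal e) sequentially"
    using ev1 ev2 ev3 ev4 eventually_gt_at_top[of 0]
  proof eventually_elim
    case (elim n)
    interpret renewal_sequence "M n" "Y n" by (rule Y)
    have mean_n: "mean = mn n" by (simp add: mean_def mn_def)
    have n: "0 < real n" using elim by simp
    have vn0: "0 \<le> vn n" unfolding vn_def by (rule variance_positive)
    have "expectation (\<lambda>\<omega>. (Y n 0 \<omega>)\<^sup>2) = vn n + (mn n)\<^sup>2"
      unfolding vn_def mn_def by (subst variance_eq[OF Y0_integrable sq_integrable]) simp
    then have lap: "laplace l \<le> 1 - r"
      using laplace_le[of l] l elim(1) by (simp add: mean_n)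
    define k1 where "k1 = nat \<lceil>(a + d) * n\<rceil>"
    \<comment> \<open>If \<open>a < d\<close>, the floor is negative and \<open>nat\<close> yields
      \<open>k2 = 0\<close>, the case without deficit; this covers \<open>u = 0\<close>.\<close>
    define k2 where "k2 = nat \<lfloor>(a - d) * n\<rfloor>"
    have "0 \<le> (a + d) * n" using ad n by simp
    then have k1: "(a + d) * n \<le> real k1" "real k1 \<le> (a + d) * n + 1" unfolding k1_def by linarith+
    have k2: "(a - d) * n - 1 \<le> real k2" "k2 = 0 \<or> real k2 \<le> (a - d) * n" unfolding k2_def by linarith+
    have k2a: "real k2 \<le> a * n" "real k2 \<le> real n * a"
    proof -
      have "(a - d) * n \<le> a * n" using d n by (intro mult_right_mono) auto
      then show "real k2 \<le> a * n" using k2(2) a n by (metis mult_nonneg_nonneg less_imp_le of_nat_0 order_trans)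
      then show "real k2 \<le> real n * a" by (simp add: mult.commute)
    qed
    have gap: "n * (d * \<mu> / 2) \<le> n * u - k2 * mean" if "k2 \<noteq> 0"
    proof -
      have "k2 * mean \<le> ((a - d) * n) * mean" using k2(2) that mean_pos by (intro mult_right_mono) auto
      also have "\<dots> = n * ((a - d) * mn n)" by (simp add: mean_n)
      also have "\<dots> \<le> n * (u - d * \<mu> / 2)" using elim(2) n by (intro mult_left_mono) auto
      finally show ?thesis by (simp add: algebra_simps)
    qed
    have gap0: "0 < n * (d * \<mu> / 2)" using n d \<mu> by simp
    have lr: "l * (n * u) \<le> r * k1"
    proof -
      have "l * (n * u) \<le> l * (n * (u + d * \<mu> / 4))" using l n d \<mu> by simp
      also have "\<dots> = r * ((a + d) * n)" using ad by (simp add: r_def)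
      also have "\<dots> \<le> r * k1" using k1 r by (intro mult_left_mono) auto
      finally show ?thesis .
    qed
    have c: "k2 = 0 \<or> k2 * mean < n * u" using gap gap0 by (cases "k2 = 0") auto
    have "n * a \<le> (a + d) * n" using d n by (simp add: algebra_simps)
    then have "real n * a \<le> real k1" using k1(1) by linarith
    then have "upper_nn_integral (M n) (\<lambda>\<omega>. ennreal \<bar>renewal_count (Y n) (n * u) \<omega> - n * a\<bar>)
      \<le> ennreal (real k1 - real k2) + ennreal (1 / r) + ennreal (k2\<^sup>2 * vn n / (n * u - k2 * mean)\<^sup>2)"
      unfolding vn_def using n u by (intro renewal_count_L1_bound[OF _ l r lap lr c k2a(2)]) auto
    also have "\<dots> = ennreal ((real k1 - real k2) + 1 / r + k2\<^sup>2 * vn n / (n * u - k2 * mean)\<^sup>2)"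
      using \<open>real n * a \<le> real k1\<close> k2a(2) r vn0 by (simp add: ennreal_plus)
    also have "\<dots> \<le> ennreal (2 * d * n + C)"
    proof (intro ennreal_leI)
      have "k2\<^sup>2 * vn n / (n * u - k2 * mean)\<^sup>2 \<le> a\<^sup>2 * (v + 1) / (d * \<mu> / 2)\<^sup>2"
      proof (cases "k2 = 0")
        case False
        have "real (k2\<^sup>2) \<le> (a * n)\<^sup>2" using k2a(1) by (simp add: power_mono)
        moreover have "(n * (d * \<mu> / 2))\<^sup>2 \<le> (n * u - k2 * mean)\<^sup>2"
          using gap[OF False] gap0 by (intro power_mono) auto
        moreover have "0 < (n * (d * \<mu> / 2))\<^sup>2" using gap0 by (rule zero_less_power)
        ultimately have "k2\<^sup>2 * vn n / (n * u - k2 * mean)\<^sup>2 \<le> ((a * n)\<^sup>2 * (v + 1)) / (n * (d * \<mu> / 2))\<^sup>2"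
          using elim(3) vn0 v by (intro frac_le mult_mono) auto
        also have "(n * (d * \<mu> / 2))\<^sup>2 = (real n)\<^sup>2 * (d * \<mu> / 2)\<^sup>2" by (rule power_mult_distrib)
        also have "(a * n)\<^sup>2 * (v + 1) = (real n)\<^sup>2 * (a\<^sup>2 * (v + 1))" by (simp add: power_mult_distrib)
        also have "\<dots> / ((real n)\<^sup>2 * (d * \<mu> / 2)\<^sup>2) = a\<^sup>2 * (v + 1) / (d * \<mu> / 2)\<^sup>2"
          using n by (intro mult_divide_mult_cancel_left) simp
        finally show ?thesis .
      qed (use v in simp)
      moreover have "real k1 - real k2 \<le> 2 * d * n + 2" using k1 k2 by (simp add: algebra_simps)
      ultimately show "(real k1 - real k2) + 1 / r + k2\<^sup>2 * vn n / (n * u - k2 * mean)\<^sup>2 \<le> 2 * d * n + C"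
        unfolding C_def by linarith
    qed
    finally have "upper_nn_integral (M n) (\<lambda>\<omega>. ennreal \<bar>renewal_count (Y n) (n * u) \<omega> / n - a\<bar>)
        \<le> ennreal ((2 * d * n + C) / n)"
      using n d C by (intro upper_nn_integral_scale_le) auto
    also have "\<dots> \<le> ennreal e"
    proof (rule ennreal_leI)
      have "(2 * d * n + C) / n = 2 * d + C / n" using n by (simp add: field_simps)
      then show "(2 * d * n + C) / n \<le> e" using elim(4) d_def d by linarith
    qed
    finally show ?case by (simp add: a_def)
  qed
qed

section \<open>Poisson processes\<close>

text \<open>Factorial moments are the convenient ones: a factor \<open>k\<close> cancels against
  \<open>fact k\<close>, and shifting the index gives back the preceding series.\<close>

lemma poisson_moments:
  fixes r :: real
  shows "(\<lambda>k. r ^ k / fact k) sums exp r"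
    and "(\<lambda>k. real k * r ^ k / fact k) sums (r * exp r)"
    and "(\<lambda>k. real k * (real k - 1) * r ^ k / fact k) sums (r\<^sup>2 * exp r)"
proof -
  show 0: "(\<lambda>k. r ^ k / fact k) sums exp r"
    using exp_converges[of r] by (simp add: divide_inverse mult.commute)
  have shift: "real (Suc k) * r ^ Suc k / fact (Suc k) = r * (r ^ k / fact k)" for k
    by (simp add: divide_simps del: of_nat_Suc)
  have "(\<lambda>k. real (Suc k) * r ^ Suc k / fact (Suc k)) sums (r * exp r)"
    unfolding shift by (intro sums_mult 0)
  then show 1: "(\<lambda>k. real k * r ^ k / fact k) sums (r * exp r)"
    by (subst (asm) sums_Suc_iff) simp
  have "real (Suc k) * (real (Suc k) - 1) * r ^ Suc k / fact (Suc k)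
      = (real (Suc k) - 1) * (real (Suc k) * r ^ Suc k / fact (Suc k))" for k by simp
  also have "(real (Suc k) - 1) * (real (Suc k) * r ^ Suc k / fact (Suc k)) = r * (real k * r ^ k / fact k)" for k
    unfolding shift by simp
  finally have shift2: "real (Suc k) * (real (Suc k) - 1) * r ^ Suc k / fact (Suc k)
    = r * (real k * r ^ k / fact k)" for k .
  have "(\<lambda>k. real (Suc k) * (real (Suc k) - 1) * r ^ Suc k / fact (Suc k)) sums (r * (r * exp r))"
    unfolding shift2 by (intro sums_mult 1)
  then show "(\<lambda>k. real k * (real k - 1) * r ^ k / fact k) sums (r\<^sup>2 * exp r)"
    by (subst (asm) sums_Suc_iff) (simp add: power2_eq_square mult.assoc)
qed

lemma nn_integral_poisson_centered_square:
  fixes r :: real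
  assumes "0 < r"
  shows "(\<integral>\<^sup>+k. ennreal ((real k - r)\<^sup>2) \<partial>measure_pmf (poisson_pmf r)) = ennreal r"
proof -
  \<comment> \<open>The centered square is expanded in factorial powers:
    \<open>(k - r)\<^sup>2 = k * (k - 1) + (1 - 2 * r) * k + r\<^sup>2\<close>.\<close>
  have "(\<lambda>k. exp (- r) * (real k * (real k - 1) * r ^ k / fact k + (1 - 2 * r) * (real k * r ^ k / fact k)
      + r\<^sup>2 * (r ^ k / fact k))) sums
    (exp (- r) * (r\<^sup>2 * exp r + (1 - 2 * r) * (r * exp r) + r\<^sup>2 * exp r))"
    by (intro sums_mult sums_add poisson_moments)
  moreover have "exp (- r) * (real k * (real k - 1) * r ^ k / fact k + (1 - 2 * r) * (real k * r ^ k / fact k)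
      + r\<^sup>2 * (r ^ k / fact k)) = r ^ k / fact k * exp (- r) * (real k - r)\<^sup>2" for k
    by (simp add: field_simps power2_eq_square)
  moreover have "exp (- r) * (r\<^sup>2 * exp r + (1 - 2 * r) * (r * exp r) + r\<^sup>2 * exp r) = r"
  proof -
    have "exp (- r) * (r\<^sup>2 * exp r + (1 - 2 * r) * (r * exp r) + r\<^sup>2 * exp r) = (exp (- r) * exp r) * r"
      by (simp add: algebra_simps power2_eq_square)
    also have "exp (- r) * exp r = 1" using exp_add[of "- r" r] by simp
    finally show ?thesis by simp
  qed
  ultimately have s: "(\<lambda>k. r ^ k / fact k * exp (- r) * (real k - r)\<^sup>2) sums r" by simp
  have "(\<integral>\<^sup>+k. ennreal ((real k - r)\<^sup>2) \<partial>measure_pmf (poisson_pmf r))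
      = (\<Sum>k. ennreal (pmf (poisson_pmf r) k) * ennreal ((real k - r)\<^sup>2))"
    by (simp only: nn_integral_measure_pmf nn_integral_count_space_nat)
  also have "\<dots> = (\<Sum>k. ennreal (r ^ k / fact k * exp (- r) * (real k - r)\<^sup>2))"
    using assms by (intro suminf_cong) (simp add: ennreal_mult[symmetric])
  also have "\<dots> = ennreal r" using s assms by (intro suminf_ennreal_eq) auto
  finally show ?thesis .
qed

text \<open>From \<open>exp (- r) \<ge> 1 - r\<close> the complement has probability at least
  \<open>(1 - r) * (1 + r)\<close>. The quadratic order in the cell length is the point: a union
  over about \<open>1 / r\<close> cells is still small.\<close>

lemma poisson_ge_2:
  fixes r :: real
  assumes "0 < r"
  shows "measure (measure_pmf (poisson_pmf r)) {k. 1 < real k} \<le> r\<^sup>2"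
proof -
  have "{k. 1 < real k} = UNIV - {0, 1 :: nat}" by (auto simp: not_less le_Suc_eq)
  then have "measure (measure_pmf (poisson_pmf r)) {k. 1 < real k} = 1 - measure (measure_pmf (poisson_pmf r)) {0, 1}"
    using measure_pmf.prob_compl[of "{0, 1}" "poisson_pmf r"] by simp
  also have "measure (measure_pmf (poisson_pmf r)) {0, 1} = exp (- r) * (1 + r)"
    using assms by (simp add: measure_measure_pmf_finite algebra_simps)
  finally have "measure (measure_pmf (poisson_pmf r)) {k. 1 < real k} = 1 - exp (- r) * (1 + r)" .
  moreover have "(1 - r) * (1 + r) \<le> exp (- r) * (1 + r)"
    using exp_ge_add_one_self[of "- r"] assms by (intro mult_right_mono) auto
  moreover have "(1 - r) * (1 + r) = 1 - r\<^sup>2" by (simp add: algebra_simps power2_eq_square)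
  ultimately show ?thesis by linarith
qed

lemma poisson_increment:
  assumes N: "unit_poisson_process M N" and st: "0 \<le> s" "s < t"
  shows "(\<lambda>\<omega>. N t \<omega> - N s \<omega>) \<in> borel_measurable M"
    and "distr M borel (\<lambda>\<omega>. N t \<omega> - N s \<omega>) = distr (measure_pmf (poisson_pmf (t - s))) borel real"
  using assms unfolding unit_poisson_process_def by (auto intro!: borel_measurable_diff)

text \<open>Pointwise \<open>\<bar>y\<bar> \<le> c + y\<^sup>2 / c\<close>, and the variance of the
  count is \<open>t\<close>. The scale \<open>c\<close> stays free so that it can be matched to the
  normalization later.\<close>

lemma upper_nn_integral_poisson_deviation:
  assumes M: "prob_space M" and N: "unit_poisson_process M N" and t: "0 \<le> t" and c: "0 < c"
  shows "upper_nn_integral M (\<lambda>\<omega>. ennreal \<bar>N t \<omega> - t\<bar>) \<le> ennreal (c + t / c)"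
\<comment> \<open>The increment law is given only for \<open>s < t\<close>; time 0 is settled by the
  almost sure start at 0.\<close>
proof (cases "t = 0")
  case True
  have "AE \<omega> in M. ennreal \<bar>N t \<omega> - t\<bar> \<le> 0"
    using N True unfolding unit_poisson_process_def by (auto elim: eventually_mono)
  then have "upper_nn_integral M (\<lambda>\<omega>. ennreal \<bar>N t \<omega> - t\<bar>) \<le> (\<integral>\<^sup>+\<omega>. 0 \<partial>M)"
    by (intro upper_nn_integral_le) auto
  then show ?thesis by simp
next
  case False
  then have t0: "0 < t" using t by simp
  interpret prob_space M by (rule M)
  have [measurable]: "(\<lambda>\<omega>. N t \<omega> - N 0 \<omega>) \<in> borel_measurable M"
    and d: "distr M borel (\<lambda>\<omega>. N t \<omega> - N 0 \<omega>) = distr (measure_pmf (poisson_pmf (t - 0))) borel real"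
    using poisson_increment[OF N, of 0 t] t0 by auto
  have sq: "(\<integral>\<^sup>+\<omega>. ennreal ((N t \<omega> - N 0 \<omega> - t)\<^sup>2) \<partial>M) = ennreal t"
  proof -
    have "(\<integral>\<^sup>+\<omega>. ennreal ((N t \<omega> - N 0 \<omega> - t)\<^sup>2) \<partial>M)
        = (\<integral>\<^sup>+y. ennreal ((y - t)\<^sup>2) \<partial>distr M borel (\<lambda>\<omega>. N t \<omega> - N 0 \<omega>))"
      by (subst nn_integral_distr) auto
    also have "\<dots> = (\<integral>\<^sup>+k. ennreal ((real k - t)\<^sup>2) \<partial>measure_pmf (poisson_pmf t))"
      unfolding d by (subst nn_integral_distr) auto
    finally show ?thesis using nn_integral_poisson_centered_square[OF t0] by simp
  qed
  have "AE \<omega> in M. N 0 \<omega> = 0"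
    using N unfolding unit_poisson_process_def by (auto elim: eventually_mono)
  then have "AE \<omega> in M. ennreal \<bar>N t \<omega> - t\<bar> \<le> ennreal c + ennreal (1 / c) * ennreal ((N t \<omega> - N 0 \<omega> - t)\<^sup>2)"
  proof eventually_elim
    case (elim \<omega>)
    let ?y = "\<bar>N t \<omega> - t\<bar>"
    have "?y \<le> c + 1 / c * ?y\<^sup>2"
    proof (cases "?y \<le> c")
      case True
      have "0 \<le> 1 / c * ?y\<^sup>2" using c by simp
      with True show ?thesis by linarith
    next
      case False
      then have "c * ?y \<le> ?y * ?y" by (intro mult_right_mono) auto
      then have "?y \<le> 1 / c * ?y\<^sup>2" using c by (simp add: pos_le_divide_eq power2_eq_square mult.commute)
      then show ?thesis using c by linarith
    qed
    then have "ennreal ?y \<le> ennreal (c + 1 / c * (N t \<omega> - t)\<^sup>2)" by (intro ennreal_leI) simp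
    also have "\<dots> = ennreal c + ennreal (1 / c) * ennreal ((N t \<omega> - t)\<^sup>2)"
      using c by (simp add: ennreal_plus ennreal_mult[symmetric])
    finally show ?case using elim by simp
  qed
  then have "upper_nn_integral M (\<lambda>\<omega>. ennreal \<bar>N t \<omega> - t\<bar>)
      \<le> (\<integral>\<^sup>+\<omega>. ennreal c + ennreal (1 / c) * ennreal ((N t \<omega> - N 0 \<omega> - t)\<^sup>2) \<partial>M)"
    by (intro upper_nn_integral_le) measurable
  also have "\<dots> = ennreal c + ennreal (1 / c) * ennreal t"
    by (subst nn_integral_add, measurable, subst nn_integral_cmult, measurable)
      (simp add: sq emeasure_space_1)
  also have "\<dots> = ennreal (c + t / c)" using c t by (simp add: ennreal_plus ennreal_mult[symmetric])
  finally show ?thesis .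
qed

lemma poisson_process_LLN:
  fixes M :: "nat \<Rightarrow> 'a measure"
  assumes M: "\<And>n. prob_space (M n)" and N: "\<And>n. unit_poisson_process (M n) (N n)" and v: "0 \<le> v"
  shows "(\<lambda>n. upper_nn_integral (M n) (\<lambda>\<omega>. ennreal \<bar>N n (real n * v) \<omega> / real n - v\<bar>)) \<longlonglongrightarrow> 0"
proof (rule tendsto_ennreal_zeroI)
  fix e :: real assume e: "0 < e"
  have "(\<lambda>n. (2 * v / e) / real n) \<longlonglongrightarrow> 0" by (rule lim_const_over_n)
  then have "eventually (\<lambda>n. (2 * v / e) / real n < e / 2) sequentially"
    using e by (intro order_tendstoD) auto
  then show "eventually (\<lambda>n. upper_nn_integral (M n) (\<lambda>\<omega>. ennreal \<bar>N n (real n * v) \<omega> / real n - v\<bar>)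
    \<le> ennreal e) sequentially"
    using eventually_gt_at_top[of 0]
  proof eventually_elim
    case (elim n)
    \<comment> \<open>With \<open>c\<close> proportional to \<open>n\<close> the first term
      contributes exactly \<open>e / 2\<close> after scaling, and the variance term is of order
      \<open>1 / n\<close>.\<close>
    let ?c = "e / 2 * real n"
    have c: "0 < ?c" using e elim by simp
    have "upper_nn_integral (M n) (\<lambda>\<omega>. ennreal \<bar>N n (real n * v) \<omega> / real n - v\<bar>)
        \<le> ennreal ((?c + real n * v / ?c) / real n)"
      using elim e v by (intro upper_nn_integral_scale_le upper_nn_integral_poisson_deviation M N c) auto
    also have "(?c + real n * v / ?c) / real n = e / 2 + (2 * v / e) / real n"
      using elim e by (simp add: field_simps)
    also have "ennreal \<dots> \<le> ennreal e" using elim by (intro ennreal_leI) simp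
    finally show ?case .
  qed
qed

section \<open>Unit jumps of Poisson paths\<close>

text \<open>On \<open>{0..K}\<close> with cells of length \<open>1 / m\<close> there are
  \<open>K * m\<close> cells, each having an increment of 2 or more with probability at most
  \<open>1 / m\<^sup>2\<close>. Hence a grid is bad with probability at most \<open>K / m\<close>,
  and a path for which every grid is bad lies in a null set.\<close>

lemma AE_poisson_grid_increments:
  assumes M: "prob_space M" and N: "unit_poisson_process M N"
  shows "AE \<omega> in M. \<forall>K::nat. \<exists>m>0. \<forall>i<K * m. N (real (Suc i) / real m) \<omega> - N (real i / real m) \<omega> \<le> 1"
proof (subst AE_all_countable, intro allI)
  fix K :: nat
  interpret prob_space M by (rule M)
  define A where "A m i = {\<omega> \<in> space M. 1 < N (real (Suc i) / real (Suc m)) \<omega> - N (real i / real (Suc m)) \<omega>}" for m i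
  define B where "B m = (\<Union>i<K * Suc m. A m i)" for m
  have lt: "real i / real (Suc m) < real (Suc i) / real (Suc m)" for i m
    by (intro divide_strict_right_mono) auto
  have A_sets [measurable]: "A m i \<in> sets M" for m i
    using poisson_increment(1)[OF N _ lt[of i m]] unfolding A_def by measurable
  have PA: "prob (A m i) \<le> (1 / real (Suc m))\<^sup>2" for m i
  proof -
    let ?D = "\<lambda>\<omega>. N (real (Suc i) / real (Suc m)) \<omega> - N (real i / real (Suc m)) \<omega>"
    have [measurable]: "?D \<in> borel_measurable M" by (rule poisson_increment(1)[OF N _ lt]) simp
    have diff: "real (Suc i) / real (Suc m) - real i / real (Suc m) = 1 / real (Suc m)"
      by (simp add: diff_divide_distrib[symmetric])
    have "prob (A m i) = measure (distr M borel ?D) {1<..}"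
      by (subst measure_distr, measurable) (auto simp: A_def intro!: arg_cong[where f = prob])
    also have "\<dots> = measure (distr (measure_pmf (poisson_pmf (1 / real (Suc m)))) borel real) {1<..}"
      using poisson_increment(2)[OF N _ lt[of i m]] by (simp only: diff) simp
    also have "\<dots> = measure (measure_pmf (poisson_pmf (1 / real (Suc m)))) {k. 1 < real k}"
      by (subst measure_distr) (auto intro!: arg_cong[where f = "measure _"])
    also have "\<dots> \<le> (1 / real (Suc m))\<^sup>2" by (rule poisson_ge_2) simp
    finally show ?thesis .
  qed
  have B_sets: "B m \<in> sets M" for m unfolding B_def by auto
  have PB: "prob (B m) \<le> real K / real (Suc m)" for m
  proof -
    have "prob (B m) \<le> (\<Sum>i<K * Suc m. prob (A m i))"
      unfolding B_def by (intro measure_UNION_le) auto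
    also have "\<dots> \<le> (\<Sum>i<K * Suc m. (1 / real (Suc m))\<^sup>2)" by (intro sum_mono PA)
    also have "\<dots> = real K / real (Suc m)"
      by (simp only: sum_constant card_lessThan of_nat_mult power2_eq_square)
        (simp add: field_simps del: of_nat_Suc)
    finally show ?thesis .
  qed
  have "prob (\<Inter>m. B m) \<le> real K / real (Suc m)" for m
    using B_sets by (intro order_trans[OF _ PB[of m]] finite_measure_mono) auto
  moreover have "(\<lambda>m. real K / real (Suc m)) \<longlonglongrightarrow> 0"
    using LIMSEQ_Suc[OF lim_const_over_n[of "real K"]] by simp
  ultimately have "prob (\<Inter>m. B m) \<le> 0"
    by (intro LIMSEQ_le_const[of _ 0]) auto
  then have "prob (\<Inter>m. B m) = 0" by (simp add: measure_le_0_iff)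
  then have "AE \<omega> in M. \<omega> \<notin> (\<Inter>m. B m)" using B_sets by (subst prob_eq_0[symmetric]) auto
  then show "AE \<omega> in M. \<exists>m>0. \<forall>i<K * m. N (real (Suc i) / real m) \<omega> - N (real i / real m) \<omega> \<le> 1"
    using AE_space
  proof eventually_elim
    case (elim \<omega>)
    then obtain m where "\<omega> \<notin> B m" by auto
    then show ?case using elim by (intro exI[of _ "Suc m"]) (auto simp: B_def A_def not_less)
  qed
qed

text \<open>By monotonicity the increment from any \<open>w'\<close> in the cell of \<open>v\<close>
  up to \<open>v\<close> is at most that of the whole cell. The conclusion expresses a jump of at
  most 1 into \<open>v\<close> without left limits, in the form to be composed with a continuous
  clock.\<close>

lemma grid_increments_imp_small_jump:
  fixes f :: "real \<Rightarrow> real"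
  assumes mono: "mono_on {0..} f"
    and grid: "\<forall>K::nat. \<exists>m>0. \<forall>i<K * m. f (real (Suc i) / real m) - f (real i / real m) \<le> 1"
    and v: "0 < v"
  shows "\<exists>w. 0 \<le> w \<and> w < v \<and> (\<forall>w'\<in>{w..v}. f v - f w' \<le> 1)"
proof -
  obtain K :: nat where K: "v \<le> real K" using real_arch_simple by blast
  obtain m where m: "0 < m" "\<And>i. i < K * m \<Longrightarrow> f (real (Suc i) / real m) - f (real i / real m) \<le> 1"
    using grid by blast
  \<comment> \<open>The ceiling minus one puts \<open>v\<close> into the cell that is open on the
    left, so the witness \<open>i / m\<close> is strictly below \<open>v\<close> even if
    \<open>v\<close> is itself a grid point.\<close>
  define i where "i = nat (\<lceil>v * m\<rceil> - 1)"
  have "0 < v * m" using v m by simp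
  then have i: "real i < v * m" "v * m \<le> real (Suc i)" unfolding i_def by linarith+
  have "v * m \<le> real K * m" using K by (intro mult_right_mono) auto
  with i(1) have "real i < real (K * m)" by simp
  then have "i < K * m" by (simp only: of_nat_less_iff)
  from m(2)[OF this] have inc: "f (real (Suc i) / real m) - f (real i / real m) \<le> 1" .
  have lo: "real i / m < v" and hi: "v \<le> real (Suc i) / m" using i m(1) by (simp_all add: field_simps)
  have "f v \<le> f (real (Suc i) / m)" using mono hi v by (intro mono_onD[OF mono]) auto
  moreover have "f (real i / m) \<le> f w'" if "w' \<in> {real i / m..v}" for w'
  proof (rule mono_onD[OF mono])
    have "0 \<le> real i / m" by simp
    moreover have "real i / m \<le> w'" using that by simp
    ultimately show "real i / m \<in> {0..}" "w' \<in> {0..}" "real i / m \<le> w'" by (simp, (metis atLeast_iff order_trans), simp)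
  qed
  ultimately have "\<forall>w'\<in>{real i / m..v}. f v - f w' \<le> 1" using inc by force
  then show ?thesis using lo by (intro exI[of _ "real i / m"]) auto
qed

section \<open>The pathwise bound\<close>

text \<open>Stated for abstract clocks \<open>I\<close> and \<open>J\<close> so that exchanging
  sellers and buyers yields the lower bound. The queue rises only through seller arrivals and
  reneging buyers, and \<open>flat\<close> excludes the latter while \<open>X\<close> is
  nonnegative; only a jump across 0 needs care.\<close>

lemma queue_upper_bound:
  fixes X S B P Q I J :: "real \<Rightarrow> real"
  assumes eq: "\<And>t. 0 \<le> t \<Longrightarrow> X t = X0 + S t - B t - P (I t) + Q (J t)"
    and int: "\<And>t. 0 \<le> t \<Longrightarrow> X t \<in> \<int>"
    and S: "mono_on {0..} S" "0 \<le> S 0" and B: "mono_on {0..} B" "0 \<le> B 0"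
    and P: "mono_on {0..} P" "0 \<le> P 0" and Q: "mono_on {0..} Q" "Q 0 = 0"
    and jump: "\<And>v. 0 < v \<Longrightarrow> \<exists>w. 0 \<le> w \<and> w < v \<and> (\<forall>w'\<in>{w..v}. Q v - Q w' \<le> 1)"
    and I: "mono_on {0..} I" "0 \<le> I 0" and J: "mono_on {0..} J" "J 0 = 0"
    and J_cont: "continuous_on {0..t} J"
    and flat: "\<And>a b. \<lbrakk>0 \<le> a; a \<le> b; \<And>s. a < s \<Longrightarrow> s \<le> b \<Longrightarrow> 0 \<le> X s\<rbrakk> \<Longrightarrow> J b = J a"
    and t: "0 \<le> t"
  shows "X t \<le> max X0 0 + S t"
proof (cases "X t \<le> 0")
  case True
  have "S 0 \<le> S t" using t by (intro mono_onD[OF S(1)]) auto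
  with True S(2) show ?thesis by linarith
next
  case False
  have S_le: "S a \<le> S b" and B_le: "B a \<le> B b" and PI_le: "P (I a) \<le> P (I b)" and J_le: "J a \<le> J b"
    and S_nonneg: "0 \<le> S a" and J_nonneg: "0 \<le> J a"
    if "0 \<le> a" "a \<le> b" for a b
  proof -
    show "S a \<le> S b" "B a \<le> B b" "J a \<le> J b"
      using that by (auto intro!: mono_onD[OF S(1)] mono_onD[OF B(1)] mono_onD[OF J(1)])
    have "I 0 \<le> I a" "I a \<le> I b" using that by (auto intro!: mono_onD[OF I(1)])
    then show "P (I a) \<le> P (I b)" using I(2) by (intro mono_onD[OF P(1)]) auto
    have "S 0 \<le> S a" "J 0 \<le> J a" using that by (auto intro!: mono_onD[OF S(1)] mono_onD[OF J(1)])
    then show "0 \<le> S a" "0 \<le> J a" using S(2) J(2) by auto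
  qed
  have incr: "X t \<le> X s + S t + (Q (J t) - Q (J s))" if "0 \<le> s" "s \<le> t" for s
    using eq[of s] eq[of t] that S_nonneg[of s t] B_le[of s t] PI_le[of s t] by linarith
  define Z where "Z = {s \<in> {0..t}. X s \<le> 0}"
  show ?thesis
  proof (cases "Z = {}")
    case True
    have "0 \<le> X s" if "0 < s" "s \<le> t" for s
    proof (rule ccontr)
      assume "\<not> 0 \<le> X s"
      with that have "s \<in> Z" by (simp add: Z_def)
      with True show False by simp
    qed
    then have "J t = J 0" using t by (intro flat) auto
    moreover have "0 \<le> P (I t)" 
      using PI_le[of 0 t] t P(1) P(2) I(2) mono_onD[OF P(1), of 0 "I 0"] by auto
    moreover have "0 \<le> B t" using B_le[of 0 t] t B(2) by auto
    ultimately show ?thesis using eq[OF t] Q(2) J(2) by simp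
  next
    case False
    \<comment> \<open>After the last time \<open>\<tau>\<close> at which the queue was non-positive no buyer reneges. If \<open>Q\<close> jumps
      into \<open>\<tau>\<close>, then by unit jumps and integrality \<open>X \<le> - 1\<close> shortly before, so the jump cannot overshoot 0.\<close>
    define \<tau> where "\<tau> = Sup Z"
    have bdd: "bdd_above Z" by (rule bdd_aboveI[of _ t]) (simp add: Z_def)
    have Z_le: "s \<le> \<tau>" if "s \<in> Z" for s using that bdd unfolding \<tau>_def by (intro cSup_upper)
    have \<tau>: "0 \<le> \<tau>" "\<tau> \<le> t"
    proof -
      obtain s where "s \<in> Z" using False by blast
      then show "0 \<le> \<tau>" using Z_le[of s] by (auto simp: Z_def)
      show "\<tau> \<le> t" unfolding \<tau>_def using False by (intro cSup_least) (auto simp: Z_def)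
    qed
    have after: "0 < X s" if "\<tau> < s" "s \<le> t" for s
      using Z_le[of s] that \<tau> by (force simp: Z_def)
    have Jt: "J t = J \<tau>" using \<tau> after by (intro flat) (auto intro: less_imp_le)
    \<comment> \<open>By \<open>incr\<close> it is enough to find a time from which the remaining
      buyer reneging can bring the queue back to 0 at most.\<close>
    obtain s where s: "0 \<le> s" "s \<le> t" "X s + (Q (J t) - Q (J s)) \<le> 0"
    proof (cases "\<tau> \<in> Z")
      case True
      then show ?thesis using that[of \<tau>] \<tau> Jt by (simp add: Z_def)
    next
      case \<tau>Z: False
      then have X\<tau>: "0 < X \<tau>" using \<tau> by (auto simp: Z_def)
      have near: "\<exists>s\<in>Z. y < s \<and> s < \<tau>" if "y < \<tau>" for y
      proof -
        have "\<exists>s\<in>Z. y < s" using that less_cSup_iff[OF False bdd] unfolding \<tau>_def by blast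
        then obtain s where "s \<in> Z" "y < s" by blast
        moreover have "s \<noteq> \<tau>" using \<open>s \<in> Z\<close> \<tau>Z by auto
        ultimately show ?thesis using Z_le[of s] by force
      qed
      obtain y where y: "y < \<tau>" "\<And>s. y < s \<Longrightarrow> s \<le> \<tau> \<Longrightarrow> 0 \<le> s \<Longrightarrow> Q (J \<tau>) - Q (J s) \<le> 1"
      \<comment> \<open>Unit jumps are known only at positive arguments of \<open>Q\<close>. If
        \<open>J \<tau> = 0\<close>, then \<open>J\<close> vanishes up to \<open>\<tau>\<close> and
        \<open>Q\<close> along it is constant.\<close>
      proof (cases "J \<tau> = 0")
        case True
        have "Q (J \<tau>) - Q (J s) \<le> 1" if "0 \<le> s" "s \<le> \<tau>" for s
        proof -
          have "J s = 0" using J_le[OF that] J_nonneg[OF that] True by simp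
          with True show ?thesis by simp
        qed
        then show ?thesis using that[of "\<tau> - 1"] by simp
      next
        case False
        then have "0 < J \<tau>" using J_nonneg[of \<tau> \<tau>] \<tau> by auto
        from jump[OF this] obtain w where w: "0 \<le> w" "w < J \<tau>" "\<And>w'. w' \<in> {w..J \<tau>} \<Longrightarrow> Q (J \<tau>) - Q w' \<le> 1"
          by blast
        have "(J \<longlongrightarrow> J \<tau>) (at \<tau> within {0..t})" using J_cont \<tau> by (auto simp: continuous_on_def)
        then have "eventually (\<lambda>s. w < J s) (at \<tau> within {0..t})" using w(2) by (rule order_tendstoD)
        then obtain \<delta> where \<delta>: "0 < \<delta>" "\<And>s. s \<in> {0..t} \<Longrightarrow> s \<noteq> \<tau> \<Longrightarrow> dist s \<tau> < \<delta> \<Longrightarrow> w < J s"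
          unfolding eventually_at by blast
        have "Q (J \<tau>) - Q (J s) \<le> 1" if "\<tau> - \<delta> < s" "s \<le> \<tau>" "0 \<le> s" for s
        proof (rule w(3))
          have "w < J s" using \<delta>(2)[of s] that \<tau> w(2) by (cases "s = \<tau>") (auto simp: dist_real_def)
          then show "J s \<in> {w..J \<tau>}" using J_le[of s \<tau>] that by auto
        qed
        then show ?thesis using that[of "\<tau> - \<delta>"] \<delta>(1) by simp
      qed
      obtain s where s: "s \<in> Z" "y < s" "s < \<tau>" using near[OF y(1)] by blast
      have s0: "0 \<le> s" using s(1) by (simp add: Z_def)
      show ?thesis
      \<comment> \<open>If the clock stands still, \<open>s\<close> itself serves. Otherwise
        \<open>flat\<close> forces a negative value at some later \<open>s'\<close>, hence a value
        of at most -1, which pays for the single possible jump.\<close>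
      proof (cases "J s = J \<tau>")
        case True
        then show ?thesis using that[of s] s \<tau> s0 Jt by (simp add: Z_def)
      next
        case False
        then have "\<exists>s'. s < s' \<and> s' \<le> \<tau> \<and> X s' < 0" using flat[of s \<tau>] s0 s(3) by force
        then obtain s' where s': "s < s'" "s' \<le> \<tau>" "X s' < 0" by blast
        have "X s' \<in> \<int>" using s' s0 by (intro int) auto
        then obtain k where k: "X s' = of_int k" by (auto elim: Ints_cases)
        with s'(3) have "X s' \<le> - 1" by simp
        moreover have "Q (J \<tau>) - Q (J s') \<le> 1" using s' s s0 by (intro y) auto
        ultimately show ?thesis using that[of s'] s' \<tau> s0 Jt by simp
      qed
    qed
    then show ?thesis using incr[OF s(1,2)] by linarith
  qed
qed

section \<open>Reneging clocks and the two-sided queue bound\<close>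

lemma set_integral_upto_properties:
  fixes f :: "real \<Rightarrow> real"
  assumes int: "\<And>t. 0 \<le> t \<Longrightarrow> set_integrable lborel {0..t} f" and nonneg: "\<And>s. 0 \<le> f s"
  defines "F \<equiv> \<lambda>t. (LINT s:{0..t}|lborel. f s)"
  shows "mono_on {0..} F" "F 0 = 0" "continuous_on {0..t} F"
    "\<lbrakk>0 \<le> a; a \<le> b; \<And>s. a < s \<Longrightarrow> s \<le> b \<Longrightarrow> f s = 0\<rbrakk> \<Longrightarrow> F b = F a"
proof -
  show "mono_on {0..} F"
  proof (rule mono_onI)
    fix r s :: real assume "r \<in> {0..}" "s \<in> {0..}" "r \<le> s"
    then show "F r \<le> F s" unfolding F_def set_lebesgue_integral_def
      by (intro integral_mono int[unfolded set_integrable_def]) (auto simp: nonneg split: split_indicator)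
  qed
  have F_eq: "F u = integral {0..u} f" if "0 \<le> u" for u
    unfolding F_def using set_borel_integral_eq_integral(2)[OF int[OF that]] .
  show "F 0 = 0" using F_eq[of 0] by simp
  show "continuous_on {0..t} F"
  proof (cases "0 \<le> t")
    case True
    have "f integrable_on {0..t}" using set_borel_integral_eq_integral(1)[OF int[OF True]] .
    then have "continuous_on {0..t} (\<lambda>u. integral {0..u} f)" by (rule indefinite_integral_continuous_1)
    then show ?thesis by (subst continuous_on_cong[OF refl F_eq]) auto
  qed simp
  show "F b = F a" if "0 \<le> a" "a \<le> b" "\<And>s. a < s \<Longrightarrow> s \<le> b \<Longrightarrow> f s = 0"
  proof -
    have "(\<lambda>s. indicator {0..b} s *\<^sub>R f s) = (\<lambda>s. indicator {0..a} s *\<^sub>R f s)"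
      using that by (intro ext) (auto simp: indicator_def not_le)
    then show ?thesis unfolding F_def set_lebesgue_integral_def by (simp only:)
  qed
qed

lemma set_integrable_max_0:
  fixes f :: "real \<Rightarrow> real"
  assumes "set_integrable M A f"
  shows "set_integrable M A (\<lambda>s. max (f s) 0)" "set_integrable M A (\<lambda>s. max (- f s) 0)"
proof -
  have *: "indicator A s *\<^sub>R max (f s) 0 = max (indicator A s *\<^sub>R f s) 0"
    "indicator A s *\<^sub>R max (- f s) 0 = max (- (indicator A s *\<^sub>R f s)) 0" for s
    by (auto simp: indicator_def)
  show "set_integrable M A (\<lambda>s. max (f s) 0)" "set_integrable M A (\<lambda>s. max (- f s) 0)"
    using assms unfolding set_integrable_def * by (auto intro!: integrable_max)
qed

text \<open>Exchanging sellers and buyers turns \<open>X\<close> into \<open>- X\<close>,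
  \<open>S\<close> into \<open>B\<close> and \<open>P\<close> into \<open>Q\<close>, so the
  one-sided bound is applied twice. The integrals supply clocks that are continuous and stand still
  while the queue has the other sign.\<close>

lemma queue_abs_bound:
  fixes X S B P Q :: "real \<Rightarrow> real"
  assumes eq: "\<And>t. 0 \<le> t \<Longrightarrow> X t = X0 + S t - B t
      - P (\<theta> * (LINT s:{0..t}|lborel. max (X s) 0)) + Q (\<gamma> * (LINT s:{0..t}|lborel. max (- X s) 0))"
    and X_int: "\<And>t. 0 \<le> t \<Longrightarrow> set_integrable lborel {0..t} X"
    and pos: "0 \<le> \<theta>" "0 \<le> \<gamma>"
    and X0: "X0 \<in> \<int>"
    and S: "mono_on {0..} S" "\<And>t. 0 \<le> t \<Longrightarrow> S t \<in> \<nat>"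
    and B: "mono_on {0..} B" "\<And>t. 0 \<le> t \<Longrightarrow> B t \<in> \<nat>"
    and P: "mono_on {0..} P" "P 0 = 0" "\<And>t. 0 \<le> t \<Longrightarrow> P t \<in> \<nat>"
    and Q: "mono_on {0..} Q" "Q 0 = 0" "\<And>t. 0 \<le> t \<Longrightarrow> Q t \<in> \<nat>"
    and jump_P: "\<And>v. 0 < v \<Longrightarrow> \<exists>w. 0 \<le> w \<and> w < v \<and> (\<forall>w'\<in>{w..v}. P v - P w' \<le> 1)"
    and jump_Q: "\<And>v. 0 < v \<Longrightarrow> \<exists>w. 0 \<le> w \<and> w < v \<and> (\<forall>w'\<in>{w..v}. Q v - Q w' \<le> 1)"
    and t: "0 \<le> t"
  shows "\<bar>X t\<bar> \<le> \<bar>X0\<bar> + S t + B t"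
proof -
  let ?I = "\<lambda>t. \<theta> * (LINT s:{0..t}|lborel. max (X s) 0)"
  let ?J = "\<lambda>t. \<gamma> * (LINT s:{0..t}|lborel. max (- X s) 0)"
  note pI = set_integral_upto_properties[OF set_integrable_max_0(1)[OF X_int] max.cobounded2]
  note pJ = set_integral_upto_properties[OF set_integrable_max_0(2)[OF X_int] max.cobounded2]
  have I: "mono_on {0..} ?I" "?I 0 = 0" "continuous_on {0..t} ?I"
    "\<And>a b. \<lbrakk>0 \<le> a; a \<le> b; \<And>s. a < s \<Longrightarrow> s \<le> b \<Longrightarrow> 0 \<le> - X s\<rbrakk> \<Longrightarrow> ?I b = ?I a"
    using pI(1,2) pos by (auto simp: mono_on_def simp del: atLeastAtMost_singleton intro!: mult_left_mono continuous_intros pI(3) pI(4))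
  have J: "mono_on {0..} ?J" "?J 0 = 0" "continuous_on {0..t} ?J"
    "\<And>a b. \<lbrakk>0 \<le> a; a \<le> b; \<And>s. a < s \<Longrightarrow> s \<le> b \<Longrightarrow> 0 \<le> X s\<rbrakk> \<Longrightarrow> ?J b = ?J a"
    using pJ(1,2) pos by (auto simp: mono_on_def simp del: atLeastAtMost_singleton intro!: mult_left_mono continuous_intros pJ(3) pJ(4))
  have IJ_nonneg: "0 \<le> ?I u" "0 \<le> ?J u" for u
    using pos unfolding set_lebesgue_integral_def by (auto intro!: mult_nonneg_nonneg Bochner_Integration.integral_nonneg)
  have nat_int: "y \<in> \<int>" if "y \<in> \<nat>" for y :: real using that Nats_subset_Ints by blast
  have Xi: "X u \<in> \<int>" if "0 \<le> u" for u
    unfolding eq[OF that]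
    by (intro Ints_add Ints_diff X0 nat_int S B P Q that IJ_nonneg)
  have Sn: "0 \<le> S u" "0 \<le> B u" if "0 \<le> u" for u
    using S(2)[OF that] B(2)[OF that] by (auto elim!: Nats_cases)
  have zero: "0 \<le> ?I 0" "0 \<le> ?J 0" "0 \<le> P 0" "0 \<le> Q 0" "0 \<le> S 0" "0 \<le> B 0"
    using IJ_nonneg P(2) Q(2) Sn[of 0] by (simp_all only: order_refl)
  have "X t \<le> max X0 0 + S t"
    by (rule queue_upper_bound[OF eq Xi S(1) zero(5) B(1) zero(6) P(1) zero(3) Q(1,2) jump_Q
          I(1) zero(1) J t])
  moreover have "- X t \<le> max (- X0) 0 + B t"
  proof (rule queue_upper_bound[OF _ _ B(1) zero(6) S(1) zero(5) Q(1) zero(4) P(1,2) jump_P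
          J(1) zero(2) I t])
    fix u :: real assume u: "0 \<le> u"
    show "- X u = - X0 + B u - S u - Q (?J u) + P (?I u)" unfolding eq[OF u] by simp
    show "- X u \<in> \<int>" using Xi[OF u] by (rule Ints_minus)
  qed
  ultimately show ?thesis using Sn[OF t] by linarith
qed

section \<open>Deviation from the fluid limit\<close>

lemma set_integral_rescale:
  fixes f :: "real \<Rightarrow> real"
  assumes c: "0 < c"
  shows "(LINT s:{0..c * u}|lborel. f s) = c * (LINT s:{0..u}|lborel. f (c * s))"
    and "set_integrable lborel {0..c * u} f \<Longrightarrow> set_integrable lborel {0..u} (\<lambda>s. f (c * s))"
proof -
  have ind: "indicator {0..c * u} (0 + c * s) = (indicator {0..u} s :: real)" for s
    using c by (auto simp: indicator_def zero_le_mult_iff)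
  show "(LINT s:{0..c * u}|lborel. f s) = c * (LINT s:{0..u}|lborel. f (c * s))"
    unfolding set_lebesgue_integral_def
    by (subst lborel_integral_real_affine[where c = c and t = 0]) (use c in \<open>simp_all only: ind\<close>, simp)
  show "set_integrable lborel {0..u} (\<lambda>s. f (c * s))" if "set_integrable lborel {0..c * u} f"
    using lborel_integrable_real_affine[OF that[unfolded set_integrable_def], of c 0] c
    unfolding set_integrable_def ind by simp
qed

lemma set_integral_diff_bound:
  fixes f g h :: "real \<Rightarrow> real"
  assumes f: "set_integrable M A f" and g: "set_integrable M A g" and h: "set_integrable M A h"
    and le: "\<And>s. s \<in> A \<Longrightarrow> \<bar>f s - g s\<bar> \<le> h s"
  shows "\<bar>(LINT s:A|M. f s) - (LINT s:A|M. g s)\<bar> \<le> (LINT s:A|M. h s)"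
proof -
  have d: "(LINT s:A|M. f s) - (LINT s:A|M. g s) = (LINT s:A|M. f s - g s)"
    using set_integral_diff(2)[OF f g] by simp
  have "(LINT s:A|M. f s - g s) \<le> (LINT s:A|M. h s)"
    using le by (intro set_integral_mono set_integral_diff(1) f g h) (auto simp: abs_le_iff)
  moreover have "- (LINT s:A|M. f s - g s) \<le> (LINT s:A|M. h s)"
  proof -
    have "(LINT s:A|M. g s - f s) \<le> (LINT s:A|M. h s)"
      using le by (intro set_integral_mono set_integral_diff(1) f g h) (auto simp: abs_le_iff)
    then show ?thesis using set_integral_diff(2)[OF f g] set_integral_diff(2)[OF g f] by simp
  qed
  ultimately show ?thesis unfolding d by (rule abs_leI)
qed

lemma set_integral_const_bound:
  fixes f :: "real \<Rightarrow> real"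
  assumes "set_integrable lborel {0..u} f" "0 \<le> u" "\<And>s. s \<in> {0..u} \<Longrightarrow> f s \<le> c"
  shows "(LINT s:{0..u}|lborel. f s) \<le> c * u"
proof -
  have i: "set_integrable lborel {0..u} (\<lambda>_. c)" by (intro borel_integrable_atLeastAtMost' continuous_intros)
  have "(LINT s:{0..u}|lborel. f s) \<le> (LINT s:{0..u}|lborel. c)" by (intro set_integral_mono assms i)
  also have "\<dots> = c * u" using assms(2) by (simp add: set_integral_const)
  finally show ?thesis .
qed

text \<open>This is the random part of the grid bound alone. It is kept apart from the deterministic
  term \<open>a * K / m\<close>, because it vanishes in mean for fixed \<open>m\<close> as
  \<open>n\<close> grows, whereas the other term needs large \<open>m\<close>.\<close>

definition grid_error :: "nat \<Rightarrow> real \<Rightarrow> real \<Rightarrow> (real \<Rightarrow> real) \<Rightarrow> real" where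
  "grid_error m K a f = (\<Sum>i\<le>m. \<bar>f (K * real i / real m) - a * (K * real i / real m)\<bar>)"

lemma grid_error_nonneg: "0 \<le> grid_error m K a f"
  unfolding grid_error_def by (intro sum_nonneg) simp

lemma grid_error_bound:
  assumes "mono_on {0..} f" "0 \<le> a" "0 < m" "v \<in> {0..K}"
  shows "\<bar>f v - a * v\<bar> \<le> grid_error m K a f + a * K / m"
  unfolding grid_error_def
  by (intro monotone_linear_grid assms mono_on_subset[OF assms(1)]) auto

text \<open>The a priori bound is at most \<open>\<bar>x0\<bar> + (\<alpha> + \<beta>) * t\<close>
  plus errors contained in \<open>E\<close>, so \<open>g\<close> bounds the queue when
  \<open>E < 1\<close>. \<open>C\<close> dominates \<open>\<rho> + \<kappa>\<close>, the Lipschitz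
  constant of the reneging terms, and \<open>K\<close> bounds both clocks. Here \<open>b\<close> is
  the scaled initial state, and \<open>\<rho>\<close>, \<open>\<kappa>\<close> are the scaled
  reneging rates. The factor of \<open>E\<close> does not depend on the path \<open>X\<close>, so
  the estimate can be integrated.\<close>

lemma fluid_deviation:
  fixes X A B P Q x :: "real \<Rightarrow> real"
  assumes t: "0 \<le> t" and m: "0 < m"
    and A: "mono_on {0..} A" and B: "mono_on {0..} B" and P: "mono_on {0..} P" and Q: "mono_on {0..} Q"
    and A_nonneg: "\<And>u. 0 \<le> u \<Longrightarrow> 0 \<le> A u" and B_nonneg: "\<And>u. 0 \<le> u \<Longrightarrow> 0 \<le> B u"
    and X_int: "set_integrable lborel {0..t} X"
    and eq: "\<And>u. u \<in> {0..t} \<Longrightarrow> X u = b + A u - B u - P (\<rho> * (LINT s:{0..u}|lborel. max (X s) 0))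
        + Q (\<kappa> * (LINT s:{0..u}|lborel. max (- X s) 0))"
    and bound: "\<And>u. u \<in> {0..t} \<Longrightarrow> \<bar>X u\<bar> \<le> \<bar>b\<bar> + A u + B u"
    and x_cont: "continuous_on {0..t} x"
    and x_eq: "\<And>u. u \<in> {0..t} \<Longrightarrow> x u = x0 + (\<alpha> - \<beta>) * u - \<theta> * (LINT s:{0..u}|lborel. max (x s) 0)
        + \<gamma> * (LINT s:{0..u}|lborel. max (- x s) 0)"
    and x_bound: "\<And>u. u \<in> {0..t} \<Longrightarrow> \<bar>x u\<bar> \<le> R"
    and pars: "0 \<le> \<alpha>" "0 \<le> \<beta>" "0 \<le> \<rho>" "0 \<le> \<kappa>" "\<rho> \<le> \<theta> + 1" "\<kappa> \<le> \<gamma> + 1" "0 < \<theta>" "0 < \<gamma>"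
  defines "g \<equiv> \<bar>x0\<bar> + (\<alpha> + \<beta>) * t + 1"
  defines "C \<equiv> \<theta> + \<gamma> + 2"
  defines "K \<equiv> C * (g * t)"
  defines "E \<equiv> \<bar>b - x0\<bar> + grid_error m t \<alpha> A + grid_error m t \<beta> B + grid_error m K 1 P + grid_error m K 1 Q
      + ((\<alpha> * t + \<beta> * t + 2 * K) / m + (\<bar>\<rho> - \<theta>\<bar> + \<bar>\<kappa> - \<gamma>\<bar>) * (R * t))"
  assumes u: "u \<in> {0..t}"
  shows "\<bar>X u - x u\<bar> \<le> (2 * exp (2 * C * t) + g + R) * E"
proof -
  define eA eB eP eQ eR where "eA = grid_error m t \<alpha> A + \<alpha> * t / m"
    and "eB = grid_error m t \<beta> B + \<beta> * t / m" and "eP = grid_error m K 1 P + K / m"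
    and "eQ = grid_error m K 1 Q + K / m"
    and "eR = (\<bar>\<rho> - \<theta>\<bar> + \<bar>\<kappa> - \<gamma>\<bar>) * (R * t)"
  have E: "E = \<bar>b - x0\<bar> + eA + eB + eP + eQ + eR"
    unfolding E_def eA_def eB_def eP_def eQ_def eR_def by (simp add: add_divide_distrib)
  have R: "0 \<le> R" using x_bound[OF u] by simp
  have g: "1 \<le> g" unfolding g_def using pars t by simp
  have C: "0 < C" unfolding C_def using pars by simp
  have K: "0 \<le> K" unfolding K_def using C g t by simp
  have e_nonneg: "0 \<le> eA" "0 \<le> eB" "0 \<le> eP" "0 \<le> eQ" "0 \<le> eR"
    unfolding eA_def eB_def eP_def eQ_def eR_def
    using grid_error_nonneg K R t m pars by (auto intro!: add_nonneg_nonneg)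
  have E_nonneg: "0 \<le> E" unfolding E using e_nonneg by simp
  have A_err: "\<bar>A u - \<alpha> * u\<bar> \<le> eA" and B_err: "\<bar>B u - \<beta> * u\<bar> \<le> eB" if "u \<in> {0..t}" for u
    unfolding eA_def eB_def using that by (auto intro!: grid_error_bound A B m pars)
  have P_err: "\<bar>P v - v\<bar> \<le> eP" and Q_err: "\<bar>Q v - v\<bar> \<le> eQ" if "v \<in> {0..K}" for v
    using grid_error_bound[OF P _ m that, of 1] grid_error_bound[OF Q _ m that, of 1]
    unfolding eP_def eQ_def by auto
  have X_le: "\<bar>X u\<bar> \<le> g - 1 + E" if u: "u \<in> {0..t}" for u
  proof -
    have "A u \<le> A t" "B u \<le> B t" using u by (auto intro!: mono_onD[OF A] mono_onD[OF B])
    moreover have "A t \<le> \<alpha> * t + eA" "B t \<le> \<beta> * t + eB" using A_err[of t] B_err[of t] t by auto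
    moreover have "\<bar>b\<bar> \<le> \<bar>x0\<bar> + \<bar>b - x0\<bar>" by simp
    ultimately show ?thesis using bound[OF u] e_nonneg unfolding E g_def by (simp add: distrib_right)
  qed
  \<comment> \<open>For \<open>E \<ge> 1\<close> the a priori bound is itself a multiple of \<open>E\<close>; this replaces uniform integrability.\<close>
  show ?thesis
  proof (cases "E < 1")
    case False
    have "\<bar>X u - x u\<bar> \<le> (g - 1 + E) + R" using X_le[OF u] x_bound[OF u] by linarith
    also have "\<dots> \<le> (g + R) * E"
    proof -
      have "(g - 1 + R) * 1 \<le> (g - 1 + R) * E" using False g R by (intro mult_left_mono) auto
      then show ?thesis by (simp add: algebra_simps)
    qed
    also have "\<dots> \<le> (2 * exp (2 * C * t) + g + R) * E" using E_nonneg by (intro mult_right_mono) auto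
    finally show ?thesis .
  next
    case True
    have sub: "{0..u} \<subseteq> {0..t}" if "u \<in> {0..t}" for u using that by auto
    have x_int: "set_integrable lborel {0..t} x" by (intro borel_integrable_atLeastAtMost' x_cont)
    have Xi: "set_integrable lborel {0..u} X" and xi: "set_integrable lborel {0..u} x" if "u \<in> {0..t}" for u
      using set_integrable_subset[OF X_int _ sub[OF that]] set_integrable_subset[OF x_int _ sub[OF that]] by auto
    note Xm = set_integrable_max_0[OF Xi] and xm = set_integrable_max_0[OF xi]
    have Di: "set_integrable lborel {0..u} (\<lambda>s. \<bar>X s - x s\<bar>)" if "u \<in> {0..t}" for u
      using that by (intro set_integrable_abs set_integral_diff(1) Xi xi)
    have main: "\<bar>X u - x u\<bar> \<le> E + C * (LINT s:{0..u}|lborel. \<bar>X s - x s\<bar>)" if u: "u \<in> {0..t}" for u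
    proof -
      define D where "D = (LINT s:{0..u}|lborel. \<bar>X s - x s\<bar>)"
      define I1 I2 j1 j2 where "I1 = (LINT s:{0..u}|lborel. max (X s) 0)"
        and "I2 = (LINT s:{0..u}|lborel. max (- X s) 0)"
        and "j1 = (LINT s:{0..u}|lborel. max (x s) 0)" and "j2 = (LINT s:{0..u}|lborel. max (- x s) 0)"
      have u0: "0 \<le> u" "u \<le> t" using u by auto
      have dI: "\<bar>I1 - j1\<bar> \<le> D" "\<bar>I2 - j2\<bar> \<le> D"
        unfolding I1_def I2_def j1_def j2_def D_def using u
        by (auto intro!: set_integral_diff_bound Xm xm Di)
      have I_nonneg: "0 \<le> I1" "0 \<le> I2" "0 \<le> j1" "0 \<le> j2" "0 \<le> D"
        unfolding I1_def I2_def j1_def j2_def D_def set_lebesgue_integral_def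
        by (auto intro!: Bochner_Integration.integral_nonneg)
      have "I1 \<le> g * u" "I2 \<le> g * u" unfolding I1_def I2_def
        using X_le True g sub[OF u] u0
        by (intro set_integral_const_bound Xm u; force simp: abs_le_iff)+
      moreover have "g * u \<le> g * t" using u0 g by (intro mult_left_mono) auto
      ultimately have I_le: "I1 \<le> g * t" "I2 \<le> g * t" by linarith+
      have "j1 \<le> R * u" "j2 \<le> R * u" unfolding j1_def j2_def
        using x_bound R sub[OF u] u0
        by (intro set_integral_const_bound xm u; force simp: abs_le_iff)+
      moreover have "R * u \<le> R * t" using u0 R by (intro mult_left_mono) auto
      ultimately have j_le: "j1 \<le> R * t" "j2 \<le> R * t" by linarith+
      have "\<rho> * I1 \<le> C * (g * t)" "\<kappa> * I2 \<le> C * (g * t)"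
        using pars I_le I_nonneg C by (auto intro!: mult_mono simp: C_def)
      \<comment> \<open>This is where \<open>E < 1\<close> confines the path-dependent clocks to
        \<open>{0..K}\<close>, on which the Poisson errors are uniform.\<close>
      then have in_K: "\<rho> * I1 \<in> {0..K}" "\<kappa> * I2 \<in> {0..K}" using pars I_nonneg by (auto simp: K_def)
      \<comment> \<open>The rate difference is made to multiply the fluid integral
        \<open>j1\<close>, bounded by \<open>R * t\<close>, instead of the integral of the queue;
        the resulting error is deterministic.\<close>
      have r: "\<bar>\<rho> * I1 - \<theta> * j1\<bar> \<le> \<rho> * D + \<bar>\<rho> - \<theta>\<bar> * (R * t)"
      proof -
        have "\<rho> * I1 - \<theta> * j1 = \<rho> * (I1 - j1) + (\<rho> - \<theta>) * j1" by (simp add: algebra_simps)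
        also have "\<bar>\<dots>\<bar> \<le> \<rho> * \<bar>I1 - j1\<bar> + \<bar>\<rho> - \<theta>\<bar> * j1"
          using abs_triangle_ineq[of "\<rho> * (I1 - j1)" "(\<rho> - \<theta>) * j1"] pars I_nonneg by (simp add: abs_mult)
        also have "\<dots> \<le> \<rho> * D + \<bar>\<rho> - \<theta>\<bar> * (R * t)"
          using dI j_le pars by (intro add_mono mult_left_mono) auto
        finally show ?thesis .
      qed
      have k: "\<bar>\<kappa> * I2 - \<gamma> * j2\<bar> \<le> \<kappa> * D + \<bar>\<kappa> - \<gamma>\<bar> * (R * t)"
      proof -
        have "\<kappa> * I2 - \<gamma> * j2 = \<kappa> * (I2 - j2) + (\<kappa> - \<gamma>) * j2" by (simp add: algebra_simps)
        also have "\<bar>\<dots>\<bar> \<le> \<kappa> * \<bar>I2 - j2\<bar> + \<bar>\<kappa> - \<gamma>\<bar> * j2"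
          using abs_triangle_ineq[of "\<kappa> * (I2 - j2)" "(\<kappa> - \<gamma>) * j2"] pars I_nonneg by (simp add: abs_mult)
        also have "\<dots> \<le> \<kappa> * D + \<bar>\<kappa> - \<gamma>\<bar> * (R * t)"
          using dI j_le pars by (intro add_mono mult_left_mono) auto
        finally show ?thesis .
      qed
      have CD: "\<rho> * D + \<kappa> * D \<le> C * D"
        unfolding distrib_right[symmetric] using pars I_nonneg by (intro mult_right_mono) (auto simp: C_def)
      define pr pk where "pr = \<bar>\<rho> - \<theta>\<bar> * (R * t)" and "pk = \<bar>\<kappa> - \<gamma>\<bar> * (R * t)"
      have "eR = pr + pk" unfolding eR_def pr_def pk_def by (rule distrib_right)
      moreover note abs_le_D1[OF r[folded pr_def]] abs_le_D2[OF r[folded pr_def]]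
        abs_le_D1[OF k[folded pk_def]] abs_le_D2[OF k[folded pk_def]]
        abs_le_D1[OF A_err[OF u]] abs_le_D2[OF A_err[OF u]] abs_le_D1[OF B_err[OF u]] abs_le_D2[OF B_err[OF u]]
        abs_le_D1[OF P_err[OF in_K(1)]] abs_le_D2[OF P_err[OF in_K(1)]]
        abs_le_D1[OF Q_err[OF in_K(2)]] abs_le_D2[OF Q_err[OF in_K(2)]] abs_ge_self[of "b - x0"] abs_ge_minus_self[of "b - x0"]
      moreover have "X u = b + A u - B u - P (\<rho> * I1) + Q (\<kappa> * I2)" unfolding I1_def I2_def by (rule eq[OF u])
      moreover have "x u = x0 + \<alpha> * u - \<beta> * u - \<theta> * j1 + \<gamma> * j2"
        using x_eq[OF u] unfolding j1_def j2_def by (simp add: left_diff_distrib)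
      ultimately show ?thesis
        using CD unfolding E D_def[symmetric] by (intro abs_leI) linarith+
    qed
    have "\<bar>X u - x u\<bar> \<le> 2 * E * exp (2 * C * t)"
    proof (rule gronwall_bounded[where D = "\<lambda>u. \<bar>X u - x u\<bar>" and B = "g + R"])
      show "\<bar>X u - x u\<bar> \<le> g + R" if "u \<in> {0..t}" for u
        using X_le[OF that] x_bound[OF that] True by linarith
    qed (use Di[of t] t E_nonneg C main u in auto)
    also have "\<dots> = 2 * exp (2 * C * t) * E" by (simp only: mult_ac)
    also have "\<dots> \<le> (2 * exp (2 * C * t) + g + R) * E"
      using E_nonneg g R by (intro mult_right_mono) auto
    finally show ?thesis .
  qed
qed

section \<open>From the path estimate to convergence in mean\<close>

theorem theorem1:
  fixes M :: "nat \<Rightarrow> 'a measure"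
    and U V :: "nat \<Rightarrow> nat \<Rightarrow> 'a \<Rightarrow> real"
    and Nsr Nbr :: "nat \<Rightarrow> real \<Rightarrow> 'a \<Rightarrow> real"
    and X :: "nat \<Rightarrow> real \<Rightarrow> 'a \<Rightarrow> real"
    and \<alpha>n \<beta>n \<sigma>n \<zeta>n \<theta>n \<gamma>n :: "nat \<Rightarrow> real"
    and \<alpha> \<beta> \<sigma> \<zeta> \<theta> \<gamma> x0 :: real
    and x :: "real \<Rightarrow> real"
  assumes prob: "\<And>n. prob_space (M n)"
    and U_indep: "\<And>n. prob_space.indep_vars (M n) (\<lambda>_. borel) (U n) UNIV"
    and U_ident: "\<And>n k. distr (M n) borel (U n k) = distr (M n) borel (U n 0)"
    and V_indep: "\<And>n. prob_space.indep_vars (M n) (\<lambda>_. borel) (V n) UNIV"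
    and V_ident: "\<And>n k. distr (M n) borel (V n k) = distr (M n) borel (V n 0)"
    and U_mean: "\<And>n. prob_space.expectation (M n) (U n 0) = 1 / \<alpha>n n"
    and U_sd: "\<And>n. sqrt (prob_space.variance (M n) (U n 0)) = \<sigma>n n"
    and V_mean: "\<And>n. prob_space.expectation (M n) (V n 0) = 1 / \<beta>n n"
    and V_sd: "\<And>n. sqrt (prob_space.variance (M n) (V n 0)) = \<zeta>n n"
    and U_pos: "\<And>n. prob_space.prob (M n) {\<omega> \<in> space (M n). 0 < U n 0 \<omega>} = 1"
    and V_pos: "\<And>n. prob_space.prob (M n) {\<omega> \<in> space (M n). 0 < V n 0 \<omega>} = 1"
    and U_ui: "unif_integrable M (\<lambda>n \<omega>. (U n 0 \<omega>)\<^sup>2)"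
    and V_ui: "unif_integrable M (\<lambda>n \<omega>. (V n 0 \<omega>)\<^sup>2)"
    and Nsr_poisson: "\<And>n. unit_poisson_process (M n) (Nsr n)"
    and Nbr_poisson: "\<And>n. unit_poisson_process (M n) (Nbr n)"
    and X0_rv: "\<And>n. X n 0 \<in> borel_measurable (M n)"
    and X0_int: "\<And>n. AE \<omega> in M n. X n 0 \<omega> \<in> \<int>"
    and indep: "\<And>n. prob_space.indep_sets (M n)
        (\<lambda>i::nat. if i = 0 then gen_events (M n) (U n) UNIV
              else if i = 1 then gen_events (M n) (V n) UNIV
              else if i = 2 then gen_events (M n) (Nsr n) {0..}
              else if i = 3 then gen_events (M n) (Nbr n) {0..}
              else gen_events (M n) (\<lambda>_::unit. X n 0) UNIV) {0..4}"
    and \<theta>n_pos: "\<And>n. 0 < \<theta>n n" and \<gamma>n_pos: "\<And>n. 0 < \<gamma>n n"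
    and X_rv: "\<And>n t. 0 \<le> t \<Longrightarrow> X n t \<in> borel_measurable (M n)"
    and X_int: "\<And>n. AE \<omega> in M n. \<forall>t\<ge>0. set_integrable lborel {0..t} (\<lambda>s. X n s \<omega>)"
    and X_eq: "\<And>n. AE \<omega> in M n. \<forall>t\<ge>0.
        X n t \<omega> = X n 0 \<omega> + renewal_count (U n) t \<omega> - renewal_count (V n) t \<omega>
          - Nsr n (\<theta>n n * (LINT s:{0..t}|lborel. max (X n s \<omega>) 0)) \<omega>
          + Nbr n (\<gamma>n n * (LINT s:{0..t}|lborel. max (- X n s \<omega>) 0)) \<omega>"
    and \<alpha>_pos: "0 < \<alpha>" and \<beta>_pos: "0 < \<beta>" and \<sigma>_pos: "0 < \<sigma>" and \<zeta>_pos: "0 < \<zeta>"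
    and \<alpha>_lim: "\<alpha>n \<longlonglongrightarrow> \<alpha>" and \<beta>_lim: "\<beta>n \<longlonglongrightarrow> \<beta>"
    and \<sigma>_lim: "\<sigma>n \<longlonglongrightarrow> \<sigma>" and \<zeta>_lim: "\<zeta>n \<longlonglongrightarrow> \<zeta>"
    and \<theta>_pos: "0 < \<theta>" and \<gamma>_pos: "0 < \<gamma>"
    and \<theta>_lim: "(\<lambda>n. real n * \<theta>n n) \<longlonglongrightarrow> \<theta>"
    and \<gamma>_lim: "(\<lambda>n. real n * \<gamma>n n) \<longlonglongrightarrow> \<gamma>"
    and init: "(\<lambda>n. \<integral>\<^sup>+\<omega>. ennreal \<bar>X n 0 \<omega> / real n - x0\<bar> \<partial>M n) \<longlonglongrightarrow> 0"
    and x_cont: "continuous_on {0..} x"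
    and x_eq: "\<And>t. 0 \<le> t \<Longrightarrow>
        x t = x0 + (\<alpha> - \<beta>) * t - \<theta> * integral {0..t} (\<lambda>s. max (x s) 0)
              + \<gamma> * integral {0..t} (\<lambda>s. max (- x s) 0)"
  shows "\<forall>t\<ge>0. (\<lambda>n. \<integral>\<^sup>+\<omega>. (SUP u\<in>{0..t}. ennreal \<bar>X n (real n * u) \<omega> / real n - x u\<bar>) \<partial>M n)
            \<longlonglongrightarrow> 0"
proof (intro allI impI)
  fix t :: real assume t: "0 \<le> t"
  have ren: "renewal_sequence (M n) (Y n)"
    if indep: "prob_space.indep_vars (M n) (\<lambda>_. borel) (Y n) UNIV"
      and ident: "\<And>k. distr (M n) borel (Y n k) = distr (M n) borel (Y n 0)"
      and pos: "prob_space.prob (M n) {\<omega> \<in> space (M n). 0 < Y n 0 \<omega>} = 1"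
      and ui: "unif_integrable M (\<lambda>n \<omega>. (Y n 0 \<omega>)\<^sup>2)" for n and Y :: "nat \<Rightarrow> nat \<Rightarrow> 'a \<Rightarrow> real"
  proof -
    interpret prob_space "M n" by (rule prob)
    show ?thesis
    proof
      show "indep_vars (\<lambda>_. borel) (Y n) UNIV" by (rule indep)
      show "distr (M n) borel (Y n k) = distr (M n) borel (Y n 0)" for k by (rule ident)
      show "AE \<omega> in M n. 0 < Y n 0 \<omega>" using AE_prob_1[OF pos] by (auto elim: eventually_mono)
      show "integrable (M n) (\<lambda>\<omega>. (Y n 0 \<omega>)\<^sup>2)" using ui unfolding unif_integrable_def by blast
    qed
  qed
  have U_ren: "renewal_sequence (M n) (U n)" and V_ren: "renewal_sequence (M n) (V n)" for n
    using ren[OF U_indep U_ident U_pos U_ui] ren[OF V_indep V_ident V_pos V_ui] by auto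
  have var: "prob_space.variance (M n) f = s\<^sup>2" if "sqrt (prob_space.variance (M n) f) = s" for n and f :: "'a \<Rightarrow> real" and s
  proof -
    interpret prob_space "M n" by (rule prob)
    show ?thesis unfolding that[symmetric] using variance_positive[of f] by simp
  qed
  have U_LLN: "(\<lambda>n. upper_nn_integral (M n) (\<lambda>\<omega>. ennreal \<bar>renewal_count (U n) (real n * u) \<omega> / real n - \<alpha> * u\<bar>)) \<longlonglongrightarrow> 0"
    if "0 \<le> u" for u
  proof -
    have "(\<lambda>n. 1 / \<alpha>n n) \<longlonglongrightarrow> 1 / \<alpha>" using \<alpha>_pos by (intro tendsto_intros \<alpha>_lim) auto
    from renewal_count_LLN[OF U_ren this[folded U_mean] _ tendsto_power[OF \<sigma>_lim, of 2, folded var[OF U_sd]] _ that]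
    show ?thesis using \<alpha>_pos by (simp add: mult.commute)
  qed
  have V_LLN: "(\<lambda>n. upper_nn_integral (M n) (\<lambda>\<omega>. ennreal \<bar>renewal_count (V n) (real n * u) \<omega> / real n - \<beta> * u\<bar>)) \<longlonglongrightarrow> 0"
    if "0 \<le> u" for u
  proof -
    have "(\<lambda>n. 1 / \<beta>n n) \<longlonglongrightarrow> 1 / \<beta>" using \<beta>_pos by (intro tendsto_intros \<beta>_lim) auto
    from renewal_count_LLN[OF V_ren this[folded V_mean] _ tendsto_power[OF \<zeta>_lim, of 2, folded var[OF V_sd]] _ that]
    show ?thesis using \<beta>_pos by (simp add: mult.commute)
  qed
  have X0_lim: "(\<lambda>n. upper_nn_integral (M n) (\<lambda>\<omega>. ennreal \<bar>X n 0 \<omega> / real n - x0\<bar>)) \<longlonglongrightarrow> 0"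
  proof (rule tendsto_sandwich[OF _ _ tendsto_const init])
    show "\<forall>\<^sub>F n in sequentially. upper_nn_integral (M n) (\<lambda>\<omega>. ennreal \<bar>X n 0 \<omega> / real n - x0\<bar>)
      \<le> (\<integral>\<^sup>+\<omega>. ennreal \<bar>X n 0 \<omega> / real n - x0\<bar> \<partial>M n)"
      by (intro always_eventually allI upper_nn_integral_le_AE) (use X0_rv in simp)
  qed simp
  have x_cont_t: "continuous_on {0..t} x" by (rule continuous_on_subset[OF x_cont]) auto
  obtain R where R: "\<And>u. u \<in> {0..t} \<Longrightarrow> \<bar>x u\<bar> \<le> R"
  proof -
    have "bounded (x ` {0..t})" by (intro compact_imp_bounded compact_continuous_image x_cont_t) simp
    then obtain a where "\<forall>y\<in>x ` {0..t}. norm y \<le> a" unfolding bounded_iff by blast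
    then show ?thesis by (intro that[of a]) auto
  qed
  \<comment> \<open>The fluid equation uses the gauge integral, the queue equation the Lebesgue
    integral; for the continuous \<open>x\<close> they agree.\<close>
  have x_eq': "x u = x0 + (\<alpha> - \<beta>) * u - \<theta> * (LINT s:{0..u}|lborel. max (x s) 0)
        + \<gamma> * (LINT s:{0..u}|lborel. max (- x s) 0)" if u: "u \<in> {0..t}" for u
  proof -
    have c: "continuous_on {0..u} x" using u by (intro continuous_on_subset[OF x_cont_t]) auto
    have "set_integrable lborel {0..u} (\<lambda>s. max (x s) 0)" "set_integrable lborel {0..u} (\<lambda>s. max (- x s) 0)"
      by (intro borel_integrable_atLeastAtMost' continuous_intros c)+
    from this[THEN set_borel_integral_eq_integral(2)] x_eq[of u] u show ?thesis by simp
  qed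

  \<comment> \<open>These are the constants of \<open>fluid_deviation\<close>; they depend on
    neither \<open>n\<close> nor \<open>m\<close>.\<close>
  define g where "g = \<bar>x0\<bar> + (\<alpha> + \<beta>) * t + 1"
  define C where "C = \<theta> + \<gamma> + 2"
  define K where "K = C * (g * t)"
  define F where "F = 2 * exp (2 * C * t) + g + R"
  have R0: "0 \<le> R" using R[of 0] t by auto
  have g1: "1 \<le> g" using \<alpha>_pos \<beta>_pos t by (simp add: g_def)
  have C0: "0 < C" using \<theta>_pos \<gamma>_pos by (simp add: C_def)
  have K0: "0 \<le> K" using C0 g1 t by (simp add: K_def)
  have F0: "0 < F" using g1 R0 by (simp add: F_def add_pos_nonneg add_pos_pos)
  \<comment> \<open>The deterministic part of the error: the discretization term, of order
    \<open>1 / m\<close>, and the mismatch between scaled and limiting reneging rates, which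
    vanishes with \<open>n\<close>.\<close>
  define rest where "rest m n = (\<alpha> * t + \<beta> * t + 2 * K) / real m
    + (\<bar>real n * \<theta>n n - \<theta>\<bar> + \<bar>real n * \<gamma>n n - \<gamma>\<bar>) * (R * t)" for m n
  define A where "A n \<omega> u = renewal_count (U n) (real n * u) \<omega> / real n" for n \<omega> u
  define B where "B n \<omega> u = renewal_count (V n) (real n * u) \<omega> / real n" for n \<omega> u
  define P where "P n \<omega> u = Nsr n (real n * u) \<omega> / real n" for n \<omega> u
  define Q where "Q n \<omega> u = Nbr n (real n * u) \<omega> / real n" for n \<omega> u

  have path: "AE \<omega> in M n. \<forall>u\<in>{0..t}. \<bar>X n (real n * u) \<omega> / real n - x u\<bar>
      \<le> F * (\<bar>X n 0 \<omega> / real n - x0\<bar> + grid_error m t \<alpha> (A n \<omega>) + grid_error m t \<beta> (B n \<omega>)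
        + grid_error m K 1 (P n \<omega>) + grid_error m K 1 (Q n \<omega>) + rest m n)"
    if n: "0 < n" and m: "0 < m" and \<theta>n_le: "real n * \<theta>n n \<le> \<theta> + 1" and \<gamma>n_le: "real n * \<gamma>n n \<le> \<gamma> + 1" for n m
  proof -
    interpret U: renewal_sequence "M n" "U n" by (rule U_ren)
    interpret V: renewal_sequence "M n" "V n" by (rule V_ren)
    have Nsr_AE: "AE \<omega> in M n. Nsr n 0 \<omega> = 0 \<and> mono_on {0..} (\<lambda>t. Nsr n t \<omega>) \<and> (\<forall>t\<ge>0. Nsr n t \<omega> \<in> \<nat> \<and> continuous (at_right t) (\<lambda>s. Nsr n s \<omega>))"
      and Nbr_AE: "AE \<omega> in M n. Nbr n 0 \<omega> = 0 \<and> mono_on {0..} (\<lambda>t. Nbr n t \<omega>) \<and> (\<forall>t\<ge>0. Nbr n t \<omega> \<in> \<nat> \<and> continuous (at_right t) (\<lambda>s. Nbr n s \<omega>))"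
      using Nsr_poisson[of n] Nbr_poisson[of n] unfolding unit_poisson_process_def by blast+
    show ?thesis
      using U.AE_regular V.AE_regular Nsr_AE Nbr_AE X0_int[of n] X_int[of n] X_eq[of n]
        AE_poisson_grid_increments[OF prob Nsr_poisson[of n]] AE_poisson_grid_increments[OF prob Nbr_poisson[of n]]
    proof eventually_elim
      case (elim \<omega>)
      have n0: "0 < real n" using n by simp
      have S_nat: "renewal_count (Y n) s \<omega> \<in> \<nat>" for Y :: "nat \<Rightarrow> nat \<Rightarrow> 'a \<Rightarrow> real" and s
        unfolding renewal_count_def by simp
      have U_mono: "mono_on {0..} (\<lambda>s. renewal_count (U n) s \<omega>)"
        by (intro mono_onI U.renewal_count_mono elim) auto
      have V_mono: "mono_on {0..} (\<lambda>s. renewal_count (V n) s \<omega>)"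
        by (intro mono_onI V.renewal_count_mono elim) auto
      have Nsr_mono: "mono_on {0..} (\<lambda>s. Nsr n s \<omega>)" and Nbr_mono: "mono_on {0..} (\<lambda>s. Nbr n s \<omega>)"
        using elim(3,4) by auto
      have X_bound: "\<bar>X n s \<omega>\<bar> \<le> \<bar>X n 0 \<omega>\<bar> + renewal_count (U n) s \<omega> + renewal_count (V n) s \<omega>" if s: "0 \<le> s" for s
      proof (rule queue_abs_bound[where P = "\<lambda>s. Nsr n s \<omega>" and Q = "\<lambda>s. Nbr n s \<omega>"
            and \<theta> = "\<theta>n n" and \<gamma> = "\<gamma>n n" and X = "\<lambda>s. X n s \<omega>" and t = s
            and S = "\<lambda>s. renewal_count (U n) s \<omega>" and B = "\<lambda>s. renewal_count (V n) s \<omega>"])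
        show "X n u \<omega> = X n 0 \<omega> + renewal_count (U n) u \<omega> - renewal_count (V n) u \<omega>
          - Nsr n (\<theta>n n * (LINT s:{0..u}|lborel. max (X n s \<omega>) 0)) \<omega>
          + Nbr n (\<gamma>n n * (LINT s:{0..u}|lborel. max (- X n s \<omega>) 0)) \<omega>" if "0 \<le> u" for u
          using elim(7) that by blast
        show "set_integrable lborel {0..u} (\<lambda>s. X n s \<omega>)" if "0 \<le> u" for u using elim(6) that by blast
        show "0 \<le> \<theta>n n" "0 \<le> \<gamma>n n" using \<theta>n_pos \<gamma>n_pos by (auto intro: less_imp_le)
        show "X n 0 \<omega> \<in> \<int>" by (rule elim(5))
        show "\<exists>w\<ge>0. w < v \<and> (\<forall>w'\<in>{w..v}. Nsr n v \<omega> - Nsr n w' \<omega> \<le> 1)" if "0 < v" for v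
          by (rule grid_increments_imp_small_jump[OF Nsr_mono elim(8) that])
        show "\<exists>w\<ge>0. w < v \<and> (\<forall>w'\<in>{w..v}. Nbr n v \<omega> - Nbr n w' \<omega> \<le> 1)" if "0 < v" for v
          by (rule grid_increments_imp_small_jump[OF Nbr_mono elim(9) that])
      qed (use elim(3,4) U_mono V_mono Nsr_mono Nbr_mono S_nat s in auto)
      have scale_mono: "mono_on {0..} (\<lambda>u. f (real n * u) / real n)" if "mono_on {0..} f" for f :: "real \<Rightarrow> real"
      proof (rule mono_onI)
        fix r s :: real assume "r \<in> {0..}" "s \<in> {0..}" "r \<le> s"
        then have "f (real n * r) \<le> f (real n * s)"
          using n0 by (intro mono_onD[OF that]) (auto intro: mult_left_mono)
        then show "f (real n * r) / real n \<le> f (real n * s) / real n" using n0 by (intro divide_right_mono) auto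
      qed
      \<comment> \<open>One factor \<open>n\<close> comes from the change of time, the other from
        scaling the state. In the argument of a reneging process the first is part of the fluid
        scaling in \<open>P\<close> and \<open>Q\<close>, and the second joins
        \<open>\<theta>n n\<close> or \<open>\<gamma>n n\<close> to form the convergent
        rate.\<close>
      have resc: "(LINT s:{0..real n * u}|lborel. max (X n s \<omega>) 0) = real n * (real n * (LINT s:{0..u}|lborel. max (X n (real n * s) \<omega> / real n) 0))"
        "(LINT s:{0..real n * u}|lborel. max (- X n s \<omega>) 0) = real n * (real n * (LINT s:{0..u}|lborel. max (- (X n (real n * s) \<omega> / real n)) 0))" for u
      proof -
        have mx: "real n * max (y / real n) 0 = max y 0" "real n * max (- (y / real n)) 0 = max (- y) 0" for y :: real
          using n0 by (auto simp: max_def field_simps)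
        have "(LINT s:{0..u}|lborel. max (X n (real n * s) \<omega>) 0) = real n * (LINT s:{0..u}|lborel. max (X n (real n * s) \<omega> / real n) 0)"
          "(LINT s:{0..u}|lborel. max (- X n (real n * s) \<omega>) 0) = real n * (LINT s:{0..u}|lborel. max (- (X n (real n * s) \<omega> / real n)) 0)"
          by (simp_all only: set_integral_mult_right[symmetric] mx)
        then show "(LINT s:{0..real n * u}|lborel. max (X n s \<omega>) 0) = real n * (real n * (LINT s:{0..u}|lborel. max (X n (real n * s) \<omega> / real n) 0))"
          "(LINT s:{0..real n * u}|lborel. max (- X n s \<omega>) 0) = real n * (real n * (LINT s:{0..u}|lborel. max (- (X n (real n * s) \<omega> / real n)) 0))"
          by (simp_all only: set_integral_rescale(1)[OF n0])
      qed
      show ?case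
        unfolding F_def g_def C_def K_def rest_def
      proof (intro ballI fluid_deviation[where X = "\<lambda>u. X n (real n * u) \<omega> / real n"])
        show "mono_on {0..} (A n \<omega>)" "mono_on {0..} (B n \<omega>)" "mono_on {0..} (P n \<omega>)" "mono_on {0..} (Q n \<omega>)"
          unfolding A_def B_def P_def Q_def by (intro scale_mono U_mono V_mono Nsr_mono Nbr_mono)+
        show "0 \<le> A n \<omega> u" "0 \<le> B n \<omega> u" for u unfolding A_def B_def renewal_count_def by simp_all
        have "set_integrable lborel {0..real n * t} (\<lambda>s. X n s \<omega>)" using elim(6) t by simp
        then show "set_integrable lborel {0..t} (\<lambda>u. X n (real n * u) \<omega> / real n)"
          by (intro set_integrable_divide set_integral_rescale(2)[OF n0])
        fix u assume u: "u \<in> {0..t}"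
        then have nu: "0 \<le> real n * u" by simp
        show "\<bar>X n (real n * u) \<omega> / real n\<bar> \<le> \<bar>X n 0 \<omega> / real n\<bar> + A n \<omega> u + B n \<omega> u"
        proof -
          have "\<bar>X n (real n * u) \<omega>\<bar> / real n \<le> (\<bar>X n 0 \<omega>\<bar> + renewal_count (U n) (real n * u) \<omega> + renewal_count (V n) (real n * u) \<omega>) / real n"
            using X_bound[OF nu] n0 by (intro divide_right_mono) auto
          then show ?thesis using n0 by (simp add: A_def B_def add_divide_distrib)
        qed
        have "X n (real n * u) \<omega> = X n 0 \<omega> + renewal_count (U n) (real n * u) \<omega> - renewal_count (V n) (real n * u) \<omega>
          - Nsr n (\<theta>n n * (LINT s:{0..real n * u}|lborel. max (X n s \<omega>) 0)) \<omega>
          + Nbr n (\<gamma>n n * (LINT s:{0..real n * u}|lborel. max (- X n s \<omega>) 0)) \<omega>"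
          using elim(7) nu by blast
        then have "X n (real n * u) \<omega> / real n = X n 0 \<omega> / real n + renewal_count (U n) (real n * u) \<omega> / real n
          - renewal_count (V n) (real n * u) \<omega> / real n
          - Nsr n (\<theta>n n * (LINT s:{0..real n * u}|lborel. max (X n s \<omega>) 0)) \<omega> / real n
          + Nbr n (\<gamma>n n * (LINT s:{0..real n * u}|lborel. max (- X n s \<omega>) 0)) \<omega> / real n"
          by (simp only: add_divide_distrib diff_divide_distrib)
        then show "X n (real n * u) \<omega> / real n = X n 0 \<omega> / real n + A n \<omega> u - B n \<omega> u
          - P n \<omega> (real n * \<theta>n n * (LINT s:{0..u}|lborel. max (X n (real n * s) \<omega> / real n) 0))
          + Q n \<omega> (real n * \<gamma>n n * (LINT s:{0..u}|lborel. max (- (X n (real n * s) \<omega> / real n)) 0))"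
          unfolding A_def B_def P_def Q_def resc by (simp only: mult_ac)
        show "x u = x0 + (\<alpha> - \<beta>) * u - \<theta> * (LINT s:{0..u}|lborel. max (x s) 0)
          + \<gamma> * (LINT s:{0..u}|lborel. max (- x s) 0)" by (rule x_eq'[OF u])
        show "\<bar>x u\<bar> \<le> R" by (rule R[OF u])
      qed (use t m x_cont_t \<alpha>_pos \<beta>_pos \<theta>_pos \<gamma>_pos \<theta>n_pos[of n] \<gamma>n_pos[of n] \<theta>n_le \<gamma>n_le n0 in auto)
    qed
  qed

  \<comment> \<open>For fixed \<open>m\<close> this has a fixed number of terms, each an error at
    one deterministic time, so the laws of large numbers apply termwise.\<close>
  define bound where "bound m n = ennreal F *
      (upper_nn_integral (M n) (\<lambda>\<omega>. ennreal \<bar>X n 0 \<omega> / real n - x0\<bar>)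
      + (\<Sum>i\<le>m. upper_nn_integral (M n) (\<lambda>\<omega>. ennreal \<bar>A n \<omega> (t * real i / real m) - \<alpha> * (t * real i / real m)\<bar>))
      + (\<Sum>i\<le>m. upper_nn_integral (M n) (\<lambda>\<omega>. ennreal \<bar>B n \<omega> (t * real i / real m) - \<beta> * (t * real i / real m)\<bar>))
      + (\<Sum>i\<le>m. upper_nn_integral (M n) (\<lambda>\<omega>. ennreal \<bar>P n \<omega> (K * real i / real m) - 1 * (K * real i / real m)\<bar>))
      + (\<Sum>i\<le>m. upper_nn_integral (M n) (\<lambda>\<omega>. ennreal \<bar>Q n \<omega> (K * real i / real m) - 1 * (K * real i / real m)\<bar>))
      + ennreal (rest m n))" for m n

  have le_bound: "(\<integral>\<^sup>+\<omega>. (SUP u\<in>{0..t}. ennreal \<bar>X n (real n * u) \<omega> / real n - x u\<bar>) \<partial>M n) \<le> bound m n"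
    if n: "0 < n" and m: "0 < m" and \<theta>n_le: "real n * \<theta>n n \<le> \<theta> + 1" and \<gamma>n_le: "real n * \<gamma>n n \<le> \<gamma> + 1" for n m
  proof -
    interpret prob_space "M n" by (rule prob)
    have rest0: "0 \<le> rest m n" unfolding rest_def using \<alpha>_pos \<beta>_pos t K0 R0 by simp
    let ?E = "\<lambda>\<omega>. ennreal \<bar>X n 0 \<omega> / real n - x0\<bar> + ennreal (grid_error m t \<alpha> (A n \<omega>))
      + ennreal (grid_error m t \<beta> (B n \<omega>)) + ennreal (grid_error m K 1 (P n \<omega>))
      + ennreal (grid_error m K 1 (Q n \<omega>)) + ennreal (rest m n)"
    have "(\<integral>\<^sup>+\<omega>. (SUP u\<in>{0..t}. ennreal \<bar>X n (real n * u) \<omega> / real n - x u\<bar>) \<partial>M n)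
        \<le> upper_nn_integral (M n) (\<lambda>\<omega>. SUP u\<in>{0..t}. ennreal \<bar>X n (real n * u) \<omega> / real n - x u\<bar>)"
      by (rule nn_integral_le_upper)
    also have "\<dots> \<le> upper_nn_integral (M n) (\<lambda>\<omega>. ennreal F * ?E \<omega>)"
    proof (rule upper_nn_integral_mono_AE)
      show "AE \<omega> in M n. (SUP u\<in>{0..t}. ennreal \<bar>X n (real n * u) \<omega> / real n - x u\<bar>) \<le> ennreal F * ?E \<omega>"
        using path[OF n m \<theta>n_le \<gamma>n_le]
      proof eventually_elim
        case (elim \<omega>)
        have "ennreal F * ?E \<omega> = ennreal (F * (\<bar>X n 0 \<omega> / real n - x0\<bar> + grid_error m t \<alpha> (A n \<omega>)
            + grid_error m t \<beta> (B n \<omega>) + grid_error m K 1 (P n \<omega>) + grid_error m K 1 (Q n \<omega>) + rest m n))"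
          using F0 rest0 grid_error_nonneg by (simp add: ennreal_mult ennreal_plus add_nonneg_nonneg)
        with elim show ?case by (intro SUP_least) (auto intro!: ennreal_leI)
      qed
    qed
    also have "\<dots> \<le> ennreal F * upper_nn_integral (M n) ?E" by (rule upper_nn_integral_cmult)
    also have "\<dots> \<le> bound m n"
    proof -
      have grid: "upper_nn_integral (M n) (\<lambda>\<omega>. ennreal (grid_error m L a (f \<omega>)))
        \<le> (\<Sum>i\<le>m. upper_nn_integral (M n) (\<lambda>\<omega>. ennreal \<bar>f \<omega> (L * real i / real m) - a * (L * real i / real m)\<bar>))"
        for L a f
        unfolding grid_error_def by (simp only: sum_ennreal[symmetric] abs_ge_zero upper_nn_integral_sum)
      show ?thesis unfolding bound_def
        by (intro mult_left_mono order_trans[OF upper_nn_integral_add] add_mono order_refl grid upper_nn_integral_const) auto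
    qed
    finally show ?thesis .
  qed

  have bound_lim: "(\<lambda>n. bound m n) \<longlonglongrightarrow> ennreal (F * ((\<alpha> * t + \<beta> * t + 2 * K) / real m))" for m
  proof -
    have pts: "0 \<le> t * real i / real m" "0 \<le> K * real i / real m" for i using t K0 by auto
    have "(\<lambda>n. rest m n) \<longlonglongrightarrow> (\<alpha> * t + \<beta> * t + 2 * K) / real m + (\<bar>\<theta> - \<theta>\<bar> + \<bar>\<gamma> - \<gamma>\<bar>) * (R * t)"
      unfolding rest_def by (intro tendsto_intros \<theta>_lim \<gamma>_lim)
    then have "(\<lambda>n. ennreal (rest m n)) \<longlonglongrightarrow> ennreal ((\<alpha> * t + \<beta> * t + 2 * K) / real m)"
      by (intro tendsto_ennrealI) simp
    then have "(\<lambda>n. bound m n) \<longlonglongrightarrow> ennreal F * (0 + (\<Sum>i\<le>m. 0) + (\<Sum>i\<le>m. 0) + (\<Sum>i\<le>m. 0) + (\<Sum>i\<le>m. 0)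
        + ennreal ((\<alpha> * t + \<beta> * t + 2 * K) / real m))"
      unfolding bound_def A_def B_def P_def Q_def mult_1
      by (intro ennreal_tendsto_cmult tendsto_add tendsto_sum X0_lim U_LLN V_LLN pts
          poisson_process_LLN prob Nsr_poisson Nbr_poisson) auto
    moreover have "ennreal (F * ((\<alpha> * t + \<beta> * t + 2 * K) / real m))
        = ennreal F * ennreal ((\<alpha> * t + \<beta> * t + 2 * K) / real m)"
      using F0 by (intro ennreal_mult') simp
    ultimately show ?thesis by simp
  qed

  show "(\<lambda>n. \<integral>\<^sup>+\<omega>. (SUP u\<in>{0..t}. ennreal \<bar>X n (real n * u) \<omega> / real n - x u\<bar>) \<partial>M n) \<longlonglongrightarrow> 0"
  proof (rule tendsto_ennreal_zeroI)
    fix e :: real assume e: "0 < e"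
    have "(\<lambda>m. F * (\<alpha> * t + \<beta> * t + 2 * K) / real m) \<longlonglongrightarrow> 0" by (rule lim_const_over_n)
    then have "eventually (\<lambda>m. F * (\<alpha> * t + \<beta> * t + 2 * K) / real m < e \<and> 0 < m) sequentially"
      using e by (intro eventually_conj order_tendstoD eventually_gt_at_top)
    then obtain m where m: "F * (\<alpha> * t + \<beta> * t + 2 * K) / real m < e" "0 < m"
      by (auto simp: eventually_sequentially)
    have "ennreal (F * ((\<alpha> * t + \<beta> * t + 2 * K) / real m)) < ennreal e"
      using m e by (intro ennreal_lessI) auto
    with bound_lim[of m] have ev: "eventually (\<lambda>n. bound m n < ennreal e) sequentially"
      by (rule order_tendstoD)
    have ev_\<theta>: "eventually (\<lambda>n. real n * \<theta>n n < \<theta> + 1) sequentially"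
      using \<theta>_lim by (rule order_tendstoD) simp
    have ev_\<gamma>: "eventually (\<lambda>n. real n * \<gamma>n n < \<gamma> + 1) sequentially"
      using \<gamma>_lim by (rule order_tendstoD) simp
    show "eventually (\<lambda>n. (\<integral>\<^sup>+\<omega>. (SUP u\<in>{0..t}. ennreal \<bar>X n (real n * u) \<omega> / real n - x u\<bar>) \<partial>M n)
      \<le> ennreal e) sequentially"
      using ev ev_\<theta> ev_\<gamma> eventually_gt_at_top[of 0]
    proof eventually_elim
      case (elim n)
      then have "(\<integral>\<^sup>+\<omega>. (SUP u\<in>{0..t}. ennreal \<bar>X n (real n * u) \<omega> / real n - x u\<bar>) \<partial>M n) \<le> bound m n"
        using m(2) by (intro le_bound) auto
      with elim(1) show ?case by simp
    qed
  qed
qed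

end
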